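(* Let $\alpha,\beta$ be positive real numbers with $\alpha\beta=\pi^2$, let $k,N$ be positive integers, and let $a>0$. Then $$ \begin{aligned} \beta^{k(N+1)-1}\sum_{n=0}^{\infty}\frac{(-1)^nF_\alpha(n+a,a;k)}{(n+a)^{2k(N+1)-1}} &=(-1)^N\alpha^{k(N+1)-1}\sum_{n=0}^{\infty}\frac{(-1)^nF_\beta(n+a,a;k)}{(n+a)^{2k(N+1)-1}}\\ &\quad+\sum_{p=0}^{N+1}(-1)^{p+1}\zeta_E(2kp,a)\,\zeta_E(2k(N-p+1),a)\,\alpha^{kp-1}\beta^{k(N+1-p)-1}. \end{aligned} $$
   Context: The alternating Hurwitz zeta function is $\zeta_E(z,x)=\sum_{n=0}^{\infty}\frac{(-1)^n}{(n+x)^z}$ for $\operatorname{Re}(z)>0$, continued analytically in $z$ to all of $\mathbb{C}$ (in particular to $z=0$). For $x>0$ and a positive integer $k$, the even-order alternating Hurwitz kernel is $$F(x,a;k)=\frac{1}{2\pi i}\int_{(c)}\frac{\zeta_E(1-s,a)}{2k\cos\left(\frac{\pi(s+k-1)}{2k}\right)}x^{-s}\,ds=-\frac{1}{2\pi x}+\frac{x^{2k-1}}{\pi}\sum_{n=0}^{\infty}\frac{(-1)^n}{(n+a)^{2k}+x^{2k}},$$ where $(c)$ is the vertical line $\operatorname{Re}(s)=c$ with $1<c<2$. For $\alpha>0$, $F_\alpha(x,a;k)=F\!\left(\frac{\alpha x}{\pi},a;k\right)$, and similarly $F_\beta$. *)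

theory Defs
  imports "HOL-Complex_Analysis.Complex_Analysis"
begin

text \<open>
  For \<open>x > 0\<close>, \<open>zeta_E z x\<close> is the value at \<open>z\<close> of the entire function that agrees with the
  (conditionally convergent) series on the half-plane \<open>Re z > 0\<close>; by the identity theorem there
  is at most one such function. For \<open>x \<le> 0\<close> nothing is claimed.
\<close>

definition zeta_E :: "complex \<Rightarrow> real \<Rightarrow> complex" where
  "zeta_E z x = (THE f. f holomorphic_on UNIV \<and>
     (\<forall>w. Re w > 0 \<longrightarrow> (\<lambda>n. (-1) ^ n / of_real (real n + x) powr w) sums f w)) z"

text \<open>The integral along the upward line \<open>Re s = c\<close>, parametrised by \<open>s = c + i t\<close>, \<open>ds = i dt\<close>.\<close>

definition vertical_line_integral :: "real \<Rightarrow> (complex \<Rightarrow> complex) \<Rightarrow> complex" where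
  "vertical_line_integral c f = (LINT t|lborel. f (Complex c t) * \<i>)"

text \<open>
  The even-order alternating Hurwitz kernel \<open>F(x,a;k)\<close>, for \<open>x > 0\<close>, \<open>a > 0\<close>, \<open>k \<ge> 1\<close>. The abscissa
  \<open>c\<close> of the line of integration is an explicit argument; it is meant to satisfy \<open>1 < c < 2\<close>.
\<close>

definition alt_hurwitz_kernel :: "real \<Rightarrow> real \<Rightarrow> real \<Rightarrow> nat \<Rightarrow> complex" where
  "alt_hurwitz_kernel c x a k =
     1 / (2 * of_real pi * \<i>) *
     vertical_line_integral c (\<lambda>s.
       zeta_E (1 - s) a / (2 * of_nat k * cos (of_real pi * (s + of_nat k - 1) / (2 * of_nat k)))
       * of_real x powr (- s))"

definition scaled_alt_hurwitz_kernel :: "real \<Rightarrow> real \<Rightarrow> real \<Rightarrow> real \<Rightarrow> nat \<Rightarrow> complex" where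
  "scaled_alt_hurwitz_kernel c \<alpha> x a k = alt_hurwitz_kernel c (\<alpha> * x / pi) a k"

end

theory Submission
  imports Defs "HOL-Probability.Sinc_Integral" "HOL-Real_Asymp.Real_Asymp"
begin

text \<open>
  Applying Euler's transformation \<open>m\<close> times to the alternating series replaces \<open>(n + a) powr (- z)\<close>
  by its \<open>m\<close>-th difference, which is \<open>O((n + a) powr (- Re z - m))\<close>; this continues \<open>zeta_E\<close> to
  \<open>Re z > 1 - m\<close>. On the line \<open>Re s = c\<close> the case \<open>m = 2\<close> of this series for \<open>zeta_E (1 - s) a\<close>
  may be integrated termwise against the kernel, and each term is an inverse Mellin transform of
  \<open>1 / sin\<close>. This yields the closed form of the kernel,
  \<open>- 1 / (2 \<pi> x) + x ^ (2 k - 1) / \<pi> * (\<Sum>n. (-1) ^ n / ((n + a) ^ (2 k) + x ^ (2 k)))\<close>.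
  With \<open>A n = (n + a) ^ (2 k)\<close> and \<open>q = (\<alpha> / \<pi>) ^ (2 k) = (\<alpha> / \<beta>) ^ k\<close>, the two sides of the
  identity then involve the absolutely convergent double series over \<open>n\<close>, \<open>m\<close> of
  \<open>(-1) ^ (n + m) / (A n ^ N * (A m + q * A n))\<close> and the one with \<open>1 / q\<close> for \<open>q\<close>. Exchanging
  \<open>n\<close> and \<open>m\<close> relates them up to a finite geometric sum, whose terms are products of zeta values;
  the summands \<open>p = 0\<close> and \<open>p = N + 1\<close> come from \<open>- 1 / (2 \<pi> x)\<close> because \<open>zeta_E 0 a = 1 / 2\<close>.
\<close>

section \<open>The alternating Hurwitz zeta function by Euler's transformation\<close>

text \<open>The \<open>m\<close>-th difference of \<open>y powr (- z)\<close>, with the sign that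
  Euler's transformation produces. The base point \<open>y\<close> is complex so that complex
  derivatives in \<open>y\<close> are available.\<close>

primrec powr_diff :: "nat \<Rightarrow> complex \<Rightarrow> complex \<Rightarrow> complex" where
  "powr_diff 0 z y = y powr (- z)"
| "powr_diff (Suc m) z y = powr_diff m z y - powr_diff m z (y + 1)"

text \<open>Differentiation in \<open>y\<close> commutes with taking differences, so it only
  multiplies by \<open>- z\<close> and raises \<open>z\<close> by one.\<close>

lemma powr_diff_has_field_derivative:
  assumes "Re y > 0"
  shows "(powr_diff m z has_field_derivative - z * powr_diff m (z + 1) y) (at y within S)"
  using assms
proof (induction m arbitrary: y S)
  case 0
  then have "((\<lambda>y. y powr (- z)) has_field_derivative - z * y powr (- z - 1)) (at y)"
    by (intro has_field_derivative_powr) (auto simp: complex_nonpos_Reals_iff)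
  moreover have "powr_diff 0 z = (\<lambda>y. y powr (- z))" by auto
  ultimately show ?case by (auto intro: has_field_derivative_at_within simp: minus_add_distrib)
next
  case (Suc m)
  have "((\<lambda>y. powr_diff m z (y + 1)) has_field_derivative - z * powr_diff m (z + 1) (y + 1)) (at y within S)"
    using Suc.IH[of "y + 1" UNIV] Suc.prems
    by (auto intro!: has_field_derivative_at_within DERIV_shift[THEN iffD1])
  then have "((\<lambda>y. powr_diff m z y - powr_diff m z (y + 1)) has_field_derivative
      - z * powr_diff m (z + 1) y - - z * powr_diff m (z + 1) (y + 1)) (at y within S)"
    by (intro DERIV_diff Suc.IH Suc.prems)
  moreover have "powr_diff (Suc m) z = (\<lambda>y. powr_diff m z y - powr_diff m z (y + 1))" by auto
  ultimately show ?case by (simp add: right_diff_distrib)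
qed

text \<open>One difference is at most the supremum of the derivative over a unit segment. The
  derivative is again a difference, of one order less and at \<open>z + 1\<close>, so the induction
  collects \<open>z * pochhammer (z + 1) m\<close>. The second hypothesis makes the power
  decreasing, which puts the supremum at the left endpoint.\<close>

lemma norm_powr_diff_le:
  assumes "y > 0" and "Re z + real m \<ge> 0"
  shows "norm (powr_diff m z (of_real y)) \<le> norm (pochhammer z m) * y powr (- Re z - real m)"
  using assms
proof (induction m arbitrary: y z)
  case 0
  then show ?case by (simp add: norm_powr_real_powr)
next
  case (Suc m)
  define S where "S = closed_segment (complex_of_real y) (of_real (y + 1))"
  define B where "B = norm z * (norm (pochhammer (z + 1) m) * y powr (- Re z - real (Suc m)))"
  have S: "\<exists>u\<ge>y. w = of_real u" if "w \<in> S" for w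
    using that unfolding S_def closed_segment_of_real by (auto simp: closed_segment_eq_real_ivl)
  have "norm (powr_diff m z (of_real y) - powr_diff m z (of_real (y + 1)))
        \<le> B * norm (complex_of_real y - of_real (y + 1))"
  proof (rule field_differentiable_bound[of S _ "\<lambda>w. - z * powr_diff m (z + 1) w"])
    show "convex S" unfolding S_def by simp
    show "(powr_diff m z has_field_derivative - z * powr_diff m (z + 1) w) (at w within S)"
      if "w \<in> S" for w
      using S[OF that] Suc.prems by (intro powr_diff_has_field_derivative) auto
    show "norm (- z * powr_diff m (z + 1) w) \<le> B" if w: "w \<in> S" for w
    proof -
      obtain u where u: "u \<ge> y" "w = of_real u" using S[OF w] by blast
      have "norm (powr_diff m (z + 1) (of_real u))
          \<le> norm (pochhammer (z + 1) m) * u powr (- Re (z + 1) - real m)"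
        using Suc.prems u by (intro Suc.IH) auto
      also have "- Re (z + 1) - real m = - Re z - real (Suc m)" by simp
      also have "u powr (- Re z - real (Suc m)) \<le> y powr (- Re z - real (Suc m))"
        using Suc.prems u by (intro powr_mono2') auto
      finally show ?thesis unfolding B_def u
        by (simp add: norm_mult mult_left_mono)
    qed
  qed (auto simp: S_def)
  also have "norm (complex_of_real y - of_real (y + 1)) = 1"
    by simp
  finally show ?case
    by (simp add: B_def pochhammer_rec norm_mult mult_ac)
qed

lemma powr_diff_holomorphic [holomorphic_intros]:
  assumes "y > 0"
  shows "(\<lambda>z. powr_diff m z (of_real y)) holomorphic_on S"
  using assms
proof (induction m arbitrary: y)
  case 0
  then show ?case by (auto intro!: holomorphic_intros)
next
  case (Suc m)
  from holomorphic_on_diff[OF Suc.IH[OF Suc.prems] Suc.IH[of "y + 1"]] Suc.prems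
  show ?case by simp
qed

section \<open>Euler's transformation of an alternating series\<close>

lemma sum_alternating_diff:
  fixes g :: "nat \<Rightarrow> complex"
  shows "(\<Sum>n<M. (-1) ^ n * (g n - g (Suc n))) = 2 * (\<Sum>n<M. (-1) ^ n * g n) - g 0 + (-1) ^ M * g M"
  by (induction M) (simp_all add: algebra_simps)

lemma alternating_diff_sums:
  fixes g :: "nat \<Rightarrow> complex"
  assumes g: "g \<longlonglongrightarrow> 0" and "(\<lambda>n. (-1) ^ n * g n) sums S"
  shows "(\<lambda>n. (-1) ^ n * (g n - g (Suc n))) sums (2 * S - g 0)"
proof -
  have "(\<lambda>M. (-1) ^ M * g M) \<longlonglongrightarrow> 0"
    using g by (subst tendsto_norm_zero_iff[symmetric]) (simp add: norm_mult norm_power tendsto_norm_zero)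
  then have "(\<lambda>M. 2 * (\<Sum>n<M. (-1) ^ n * g n) - g 0 + (-1) ^ M * g M) \<longlonglongrightarrow> 2 * S - g 0 + 0"
    using assms(2) unfolding sums_def by (intro tendsto_intros)
  then show ?thesis unfolding sums_def sum_alternating_diff by simp
qed

text \<open>The converse of the preceding step. Convergence is assumed only for the difference
  series, so conditional convergence of the original series can be deduced from absolute convergence
  after one step.\<close>

lemma alternating_sums_from_diff:
  fixes g :: "nat \<Rightarrow> complex"
  assumes g: "g \<longlonglongrightarrow> 0" and "(\<lambda>n. (-1) ^ n * (g n - g (Suc n))) sums D"
  shows "(\<lambda>n. (-1) ^ n * g n) sums ((g 0 + D) / 2)"
proof -
  have "(\<lambda>M. (-1) ^ M * g M) \<longlonglongrightarrow> 0"
    using g by (subst tendsto_norm_zero_iff[symmetric]) (simp add: norm_mult norm_power tendsto_norm_zero)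
  then have "(\<lambda>M. (g 0 + (\<Sum>n<M. (-1) ^ n * (g n - g (Suc n))) - (-1) ^ M * g M) / 2)
             \<longlonglongrightarrow> (g 0 + D - 0) / 2"
    using assms(2) unfolding sums_def by (intro tendsto_intros) auto
  then show ?thesis unfolding sums_def sum_alternating_diff by simp
qed

section \<open>Analytic continuation by repeated Euler steps\<close>

context
  fixes a :: real
  assumes a: "a > 0"
begin

text \<open>The result of \<open>m\<close> Euler steps: the finite sum collects the initial terms
  split off on the way, and the remaining series has been halved \<open>m\<close> times. For
  \<open>m = 0\<close> it is the original series.\<close>

definition euler_cont :: "nat \<Rightarrow> complex \<Rightarrow> complex" where
  "euler_cont m z = (\<Sum>j<m. powr_diff j z (of_real a) / 2 ^ Suc j)
     + (\<Sum>n. (-1) ^ n * powr_diff m z (of_real (real n + a))) / 2 ^ m"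

lemma summable_shifted_powr:
  assumes "s < -1"
  shows "summable (\<lambda>n. (real n + a) powr s)"
proof (rule summable_comparison_test_ev)
  show "summable (\<lambda>n. real n powr s)" using assms by (simp add: summable_real_powr_iff)
  show "\<forall>\<^sub>F n in sequentially. norm ((real n + a) powr s) \<le> real n powr s"
    using eventually_gt_at_top[of 0]
    by eventually_elim (use a assms in \<open>auto intro!: powr_mono2'\<close>)
qed

lemma summable_norm_powr_diff:
  assumes "Re z > 1 - real m"
  shows "summable (\<lambda>n. norm (powr_diff m z (of_real (real n + a))))"
proof (rule summable_comparison_test)
  show "summable (\<lambda>n. norm (pochhammer z m) * (real n + a) powr (- Re z - real m))"
    using assms by (intro summable_mult summable_shifted_powr) auto
  show "\<exists>N. \<forall>n\<ge>N. norm (norm (powr_diff m z (of_real (real n + a))))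
     \<le> norm (pochhammer z m) * (real n + a) powr (- Re z - real m)"
    using norm_powr_diff_le[of "real n + a" z m for n] a assms by auto
qed

lemma summable_powr_diff:
  assumes "Re z > 1 - real m"
  shows "summable (\<lambda>n. (-1) ^ n * powr_diff m z (of_real (real n + a)))"
  by (rule summable_norm_cancel)
     (use summable_norm_powr_diff[OF assms] in \<open>simp add: norm_mult norm_power\<close>)

text \<open>The half-plane is larger by one than that of absolute summability. For
  \<open>m = 0\<close> it is \<open>Re z > 0\<close>, as the conditionally convergent series
  requires.\<close>

lemma powr_diff_tendsto_0:
  assumes "Re z > - real m"
  shows "(\<lambda>n. powr_diff m z (of_real (real n + a))) \<longlonglongrightarrow> 0"
proof (rule Lim_null_comparison)
  show "\<forall>\<^sub>F n in sequentially. norm (powr_diff m z (of_real (real n + a)))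
     \<le> norm (pochhammer z m) * (real n + a) powr (- Re z - real m)"
    using norm_powr_diff_le[of "real n + a" z m for n] a assms by (intro always_eventually allI) auto
  have "filterlim (\<lambda>n. real n + a) at_top sequentially"
    by real_asymp
  then have "(\<lambda>n. (real n + a) powr (- Re z - real m)) \<longlonglongrightarrow> 0"
    using assms by (intro tendsto_neg_powr) auto
  from tendsto_mult_right_zero[OF this]
  show "(\<lambda>n. norm (pochhammer z m) * (real n + a) powr (- Re z - real m)) \<longlonglongrightarrow> 0" .
qed

lemma powr_diff_Suc_shift:
  "powr_diff (Suc m) z (of_real (real n + a)) =
     powr_diff m z (of_real (real n + a)) - powr_diff m z (of_real (real (Suc n) + a))"
  by (simp add: add_ac)

lemma euler_cont_Suc:
  assumes "Re z > 1 - real m"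
  shows "euler_cont (Suc m) z = euler_cont m z"
proof -
  define S where "S = (\<Sum>n. (-1) ^ n * powr_diff m z (of_real (real n + a)))"
  have "(\<lambda>n. (-1) ^ n * powr_diff m z (of_real (real n + a))) sums S"
    unfolding S_def using summable_powr_diff[OF assms] by (rule summable_sums)
  from alternating_diff_sums[OF powr_diff_tendsto_0 this] assms
  have "(\<lambda>n. (-1) ^ n * powr_diff (Suc m) z (of_real (real n + a))) sums
      (2 * S - powr_diff m z (of_real a))"
    unfolding powr_diff_Suc_shift by simp
  then have eq: "(\<Sum>n. (-1) ^ n * powr_diff (Suc m) z (of_real (real n + a))) = 2 * S - powr_diff m z (of_real a)"
    by (rule sums_unique[symmetric])
  show ?thesis
    unfolding euler_cont_def eq S_def[symmetric] by (simp add: field_simps)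
qed

lemma euler_cont_eq:
  assumes "Re z > 1 - real m" "Re z > 1 - real m'"
  shows "euler_cont m z = euler_cont m' z"
proof -
  have "euler_cont (m + d) z = euler_cont m z" if "Re z > 1 - real m" for m d
    using that by (induction d) (auto simp: euler_cont_Suc)
  from this[of m "m' - m"] this[of m' "m - m'"] assms show ?thesis
    by (cases "m \<le> m'") auto
qed

text \<open>After one Euler step the series converges absolutely for \<open>Re z > 0\<close>;
  undoing that step recovers the original series.\<close>

lemma euler_cont_sums:
  assumes "Re z > 0"
  shows "(\<lambda>n. (-1) ^ n / of_real (real n + a) powr z) sums euler_cont 1 z"
proof -
  have "(\<lambda>n. (-1) ^ n * powr_diff 1 z (of_real (real n + a))) sums
       (\<Sum>n. (-1) ^ n * powr_diff 1 z (of_real (real n + a)))"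
    using assms by (intro summable_sums summable_powr_diff) auto
  then have "(\<lambda>n. (-1) ^ n * (powr_diff 0 z (of_real (real n + a)) - powr_diff 0 z (of_real (real (Suc n) + a)))) sums
       (\<Sum>n. (-1) ^ n * powr_diff 1 z (of_real (real n + a)))"
    by (subst (asm) (1) One_nat_def, subst (asm) powr_diff_Suc_shift)
  from alternating_sums_from_diff[OF powr_diff_tendsto_0 this] assms
  show ?thesis
    by (simp add: euler_cont_def powr_minus field_simps)
qed

text \<open>Weierstrass M-test on closed discs: the Pochhammer factor is bounded by compactness, and
  the powers are dominated by a single summable one.\<close>

lemma euler_cont_holomorphic: "euler_cont m holomorphic_on {z. Re z > 1 - real m}"
proof -
  let ?S = "{z. Re z > 1 - real m}"
  let ?g = "\<lambda>z. \<Sum>n. (-1) ^ n * powr_diff m z (of_real (real n + a))"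
  have opn: "open ?S" by (rule open_halfspace_Re_gt)
  have "?g holomorphic_on ?S"
  proof (rule holomorphic_uniform_sequence[OF opn])
    show "(\<lambda>z. \<Sum>n<M. (-1) ^ n * powr_diff m z (of_real (real n + a))) holomorphic_on ?S" for M
      using a by (intro holomorphic_intros) auto
    fix z assume "z \<in> ?S"
    then obtain d where d: "d > 0" "cball z d \<subseteq> ?S"
      using opn open_contains_cball by blast
    \<comment> \<open>The largest exponent on the disc, attained at its leftmost point
      \<open>z - d\<close>. That this point still lies in \<open>?S\<close> gives
      \<open>t < -1\<close>.\<close>
    define t where "t = - (Re z - d) - real m"
    have "z - of_real d \<in> ?S" using d by (intro subsetD[OF d(2)]) (auto simp: dist_norm)
    then have t: "t < -1" by (simp add: t_def)
    have "compact ((\<lambda>w. pochhammer w m) ` cball z d)"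
      by (intro compact_continuous_image continuous_intros) auto
    then obtain B where B: "\<And>w. w \<in> cball z d \<Longrightarrow> norm (pochhammer w m) \<le> B"
      by (meson bounded_iff compact_imp_bounded imageI)
    have "B \<ge> 0" using B[of z] d norm_ge_zero order_trans by (metis centre_in_cball less_imp_le)
    have "uniform_limit (cball z d) (\<lambda>M z. \<Sum>n<M. (-1) ^ n * powr_diff m z (of_real (real n + a))) ?g sequentially"
    proof (rule Weierstrass_m_test_ev)
      show "summable (\<lambda>n. B * real n powr t)" using t by (simp add: summable_real_powr_iff summable_mult)
      show "\<forall>\<^sub>F n in sequentially. \<forall>w\<in>cball z d.
          norm ((-1) ^ n * powr_diff m w (of_real (real n + a))) \<le> B * real n powr t"
        using eventually_gt_at_top[of 0]
      proof eventually_elim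
        case (elim n)
        show ?case
        proof
          fix w assume w: "w \<in> cball z d"
          then have "w \<in> ?S" using d by blast
          have "\<bar>Re (z - w)\<bar> \<le> d" using w by (metis abs_Re_le_cmod dist_norm mem_cball order_trans)
          then have *: "- Re w - real m \<le> t" unfolding t_def by simp
          have "norm (powr_diff m w (of_real (real n + a))) \<le> norm (pochhammer w m) * (real n + a) powr (- Re w - real m)"
            using \<open>w \<in> ?S\<close> a by (intro norm_powr_diff_le) auto
          also have "\<dots> \<le> B * (real n + a) powr t"
            using B[OF w] \<open>B \<ge> 0\<close> elim a * by (intro mult_mono powr_mono) auto
          also have "(real n + a) powr t \<le> real n powr t"
            using a elim t by (intro powr_mono2') auto
          finally show "norm ((-1) ^ n * powr_diff m w (of_real (real n + a))) \<le> B * real n powr t"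
            using \<open>B \<ge> 0\<close> by (simp add: norm_mult norm_power mult_left_mono)
        qed
      qed
    qed
    then show "\<exists>d>0. cball z d \<subseteq> ?S \<and> uniform_limit (cball z d)
        (\<lambda>M z. \<Sum>n<M. (-1) ^ n * powr_diff m z (of_real (real n + a))) ?g sequentially"
      using d by blast
  qed
  then show ?thesis unfolding euler_cont_def using a by (intro holomorphic_intros) auto
qed

lemma zeta_E_eq_euler_cont:
  assumes "Re z > 1 - real m"
  shows "zeta_E z a = euler_cont m z"
proof -
  \<comment> \<open>The continuations for the various \<open>m\<close> are glued by letting the
    number of steps depend on \<open>z\<close>; this number always satisfies
    \<open>Re z > 1 - m\<close>.\<close>
  define f where "f z = euler_cont (nat \<lceil>2 - Re z\<rceil>) z" for z
  have f_eq: "f z = euler_cont m z" if "Re z > 1 - real m" for z m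
    unfolding f_def using that by (intro euler_cont_eq) linarith
  have "f holomorphic_on (\<Union>m. {z. Re z > 1 - real m})"
    using holomorphic_transform[OF euler_cont_holomorphic] f_eq
    by (intro holomorphic_on_UN_open open_halfspace_Re_gt) (metis mem_Collect_eq)
  moreover have "(\<Union>m. {z. Re z > 1 - real m}) = UNIV"
  proof -
    have "\<exists>m. Re z > 1 - real m" for z using reals_Archimedean2[of "1 - Re z"] by (auto simp: field_simps)
    then show ?thesis by auto
  qed
  ultimately have hol: "f holomorphic_on UNIV" by simp
  have sums: "(\<lambda>n. (-1) ^ n / of_real (real n + a) powr w) sums f w" if "Re w > 0" for w
    using euler_cont_sums[OF that] f_eq[of 1 w] that by simp
  \<comment> \<open>Existence is the glued function; uniqueness is the identity theorem, since any
    two candidates have the same series sum on the right half-plane.\<close>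
  have "(THE f. f holomorphic_on UNIV \<and>
     (\<forall>w. Re w > 0 \<longrightarrow> (\<lambda>n. (-1) ^ n / of_real (real n + a) powr w) sums f w)) = f"
  proof (rule the_equality)
    show "f holomorphic_on UNIV \<and> (\<forall>w. Re w > 0 \<longrightarrow> (\<lambda>n. (-1) ^ n / of_real (real n + a) powr w) sums f w)"
      using hol sums by blast
  next
    fix h assume h: "h holomorphic_on UNIV \<and>
      (\<forall>w. Re w > 0 \<longrightarrow> (\<lambda>n. (-1) ^ n / of_real (real n + a) powr w) sums h w)"
    have "h w - f w = 0" for w
    proof (rule analytic_continuation_open[where s = "{w. Re w > 0}" and s' = UNIV and g = "\<lambda>_. 0" and f = "\<lambda>w. h w - f w"])
      show "{w. 0 < Re w} \<noteq> {}" by (auto intro: exI[of _ 1])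
      show "h w - f w = 0" if "w \<in> {w. 0 < Re w}" for w
        using that h sums[of w] sums_unique2 by fastforce
    qed (use h hol in \<open>auto intro!: holomorphic_intros simp: open_halfspace_Re_gt\<close>)
    then show "h = f" by auto
  qed
  then show ?thesis unfolding zeta_E_def by (simp add: f_eq[OF assms])
qed

text \<open>At \<open>z = 0\<close> the function being differenced is the constant \<open>1\<close>,
  so all proper differences vanish and only the first split-off term \<open>1 / 2\<close> is left.
  Two Euler steps suffice to reach \<open>z = 0\<close>.\<close>

lemma zeta_E_0: "zeta_E 0 a = 1 / 2"
proof -
  have "powr_diff (Suc m) 0 (of_real y) = 0" if "y > 0" for m y
    using that
  proof (induction m arbitrary: y)
    case 0
    then have "complex_of_real y \<noteq> 0" "complex_of_real (y + 1) \<noteq> 0"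
      unfolding of_real_eq_0_iff by auto
    then show ?case by simp
  next
    case (Suc m)
    from Suc.IH[of y] Suc.IH[of "y + 1"] Suc.prems show ?case by simp
  qed
  note this[of _ 0] this[of _ 1]
  then show ?thesis
    using a by (subst zeta_E_eq_euler_cont[of 2])
       (auto simp: euler_cont_def numeral_2_eq_2 of_real_add[symmetric] simp del: of_real_add)
qed

lemma zeta_E_of_nat_sums:
  assumes "m > 0"
  shows "(\<lambda>n. (-1) ^ n / of_real (real n + a) ^ m) sums zeta_E (of_nat m) a"
proof -
  have nz: "complex_of_real (real n + a) \<noteq> 0" for n
    using a by (metis add_nonneg_pos less_numeral_extra(3) of_nat_0_le_iff of_real_eq_0_iff)
  have "zeta_E (of_nat m) a = euler_cont 1 (of_nat m)"
    using assms by (intro zeta_E_eq_euler_cont) auto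
  then show ?thesis
    using euler_cont_sums[of "of_nat m"] assms by (simp only: powr_complexpow[OF nz]) simp
qed

end

section \<open>The inverse Mellin transform of the cosecant\<close>

text \<open>Three terms of the Taylor series. The quartic one is what later lets the kernel absorb a
  quadratic factor and still decay like \<open>1 / (1 + t ^ 2)\<close>.\<close>

lemma cosh_ge: "1 + x ^ 2 / 2 + x ^ 4 / 24 \<le> cosh (x::real)"
proof -
  let ?f = "\<lambda>n. if even n then x ^ n /\<^sub>R fact n else 0"
  have "sum ?f {0, 2, 4} \<le> suminf ?f"
    using cosh_converges[of x]
    by (intro sum_le_suminf) (auto simp: sums_iff zero_le_even_power)
  then show ?thesis
    using cosh_converges[of x] by (simp add: sums_iff fact_numeral field_simps)
qed

section \<open>Lower bounds for the complex sine\<close>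

lemma norm_sin_squared_sinh: "norm (sin z) ^ 2 = sin (Re z) ^ 2 + sinh (Im z) ^ 2"
proof -
  have "sin z = cos (of_real (pi / 2) - z)" by (simp add: cos_diff)
  then have "norm (sin z) ^ 2 = cos (pi / 2 - Re z) ^ 2 + sinh (- Im z) ^ 2"
    by (simp only: norm_cos_squared) (simp add: sinh_field_def exp_minus power_divide)
  then show ?thesis by (simp add: cos_diff)
qed

text \<open>For vertical lines that avoid the zeros of sine: \<open>sin (Re z)\<close> is then a
  nonzero constant and \<open>cosh\<close> gives exponential growth.\<close>

lemma norm_sin_ge: "\<bar>sin (Re z)\<bar> * cosh (Im z) \<le> norm (sin z)"
proof (rule power2_le_imp_le)
  have "norm (sin z) ^ 2 = (\<bar>sin (Re z)\<bar> * cosh (Im z)) ^ 2 + (cos (Re z) * sinh (Im z)) ^ 2"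
    unfolding norm_sin_squared_sinh
    by (simp add: power_mult_distrib cosh_square_eq cos_squared_eq algebra_simps)
  then show "(\<bar>sin (Re z)\<bar> * cosh (Im z)) ^ 2 \<le> norm (sin z) ^ 2" by simp
qed simp

text \<open>For horizontal segments: the bound does not involve \<open>Re z\<close>, so it survives
  where \<open>sin (Re z)\<close> vanishes.\<close>

lemma norm_sin_ge_sinh: "\<bar>sinh (Im z)\<bar> \<le> norm (sin z)"
  by (rule power2_le_imp_le) (auto simp: norm_sin_squared_sinh)

section \<open>Integrability and truncation of line integrals\<close>

lemma integrable_decay:
  fixes f :: "real \<Rightarrow> complex"
  assumes "continuous_on UNIV f" and "\<And>t. norm (f t) \<le> C / (1 + t ^ 2)"
  shows "integrable lborel f"
proof (rule Bochner_Integration.integrable_bound)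
  have "integrable lborel (\<lambda>x::real. inverse (1 + x ^ 2))"
    using integrable_inverse_1_plus_square by (simp add: set_integrable_def)
  then show "integrable lborel (\<lambda>t::real. C * inverse (1 + t ^ 2))" by simp
  show "f \<in> borel_measurable lborel"
    using borel_measurable_continuous_onI[OF assms(1)] by simp
  have "norm (f t) \<le> norm (C * inverse (1 + t ^ 2))" for t
    using assms(2)[of t] abs_ge_self[of "C / (1 + t ^ 2)"] by (simp add: divide_inverse)
  then show "AE t in lborel. norm (f t) \<le> norm (C * inverse (1 + t ^ 2))" by simp
qed

text \<open>Connects contour integrals over finite segments, which are expressed by
  \<open>integral\<close>, with the Lebesgue integral over the whole line, by dominated
  convergence.\<close>

lemma integral_symmetric_tendsto:
  fixes f :: "real \<Rightarrow> complex"
  assumes f: "integrable lborel f"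
  shows "(\<lambda>n. integral {- real n..real n} f) \<longlonglongrightarrow> (LINT t|lborel. f t)"
proof -
  have "(\<lambda>n. LINT t|lborel. indicator {- real n..real n} t *\<^sub>R f t) \<longlonglongrightarrow> (LINT t|lborel. f t)"
  proof (rule integral_dominated_convergence[where w = "\<lambda>t. norm (f t)"])
    show "AE t in lborel. (\<lambda>n. indicator {- real n..real n} t *\<^sub>R f t) \<longlonglongrightarrow> f t"
    proof (intro AE_I2 tendsto_eventually)
      fix t :: real
      obtain N where "\<bar>t\<bar> \<le> real N" using real_arch_simple by blast
      then show "\<forall>\<^sub>F n in sequentially. indicator {- real n..real n} t *\<^sub>R f t = f t"
        by (intro eventually_sequentiallyI[of N]) (auto simp: indicator_def)
    qed
    show "AE t in lborel. norm (indicator {- real n..real n} t *\<^sub>R f t) \<le> norm (f t)" for n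
      by (auto simp: indicator_def)
  qed (use f in auto)
  moreover have "(LINT t|lborel. indicator {- real n..real n} t *\<^sub>R f t) = integral {- real n..real n} f" for n
    using set_borel_integral_eq_integral(2)[of "{- real n..real n}" f] f
    by (simp add: set_lebesgue_integral_def set_integrable_def integrable_mult_indicator)
  ultimately show ?thesis by simp
qed

lemma powr_over_sin_decay:
  assumes "W > 0" "sin (pi * \<sigma>) \<noteq> 0"
  shows "norm (of_real W powr (Complex \<sigma> t) / sin (of_real pi * Complex \<sigma> t))
     \<le> (W powr \<sigma> / \<bar>sin (pi * \<sigma>)\<bar>) / (1 + t ^ 2)"
proof -
  have "1 + t ^ 2 \<le> 1 + (pi * t) ^ 2 / 2 + (pi * t) ^ 4 / 24"
  proof -
    have "2 * 2 \<le> pi * pi" using pi_gt3 by (intro mult_mono) auto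
    then have "2 * t ^ 2 \<le> pi ^ 2 * t ^ 2" by (intro mult_right_mono) (auto simp: power2_eq_square)
    moreover have "pi ^ 4 * t ^ 4 / 24 \<ge> 0" by (simp add: zero_le_even_power)
    ultimately show ?thesis unfolding power_mult_distrib by linarith
  qed
  also have "\<dots> \<le> cosh (pi * t)" by (rule cosh_ge)
  finally have c: "1 + t ^ 2 \<le> cosh (pi * t)" .
  have "\<bar>sin (pi * \<sigma>)\<bar> * (1 + t ^ 2) \<le> \<bar>sin (pi * \<sigma>)\<bar> * cosh (pi * t)"
    using c by (intro mult_left_mono) auto
  also have "\<dots> \<le> norm (sin (of_real pi * Complex \<sigma> t))"
    using norm_sin_ge[of "of_real pi * Complex \<sigma> t"] by simp
  finally have *: "\<bar>sin (pi * \<sigma>)\<bar> * (1 + t ^ 2) \<le> norm (sin (of_real pi * Complex \<sigma> t))" .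
  moreover have "\<bar>sin (pi * \<sigma>)\<bar> * (1 + t ^ 2) > 0" using assms by (intro mult_pos_pos add_pos_nonneg) auto
  ultimately show ?thesis
    using assms by (simp add: norm_divide norm_powr_real_powr divide_divide_eq_left frac_le)
qed

text \<open>
  The integrand changes by the factor \<open>-W\<close> under \<open>s \<mapsto> s + 1\<close>, so integrating over the boundary
  of a strip of width one around the pole at \<open>1\<close> yields \<open>1 + W\<close> times the line integral.
\<close>

lemma integral_powr_over_sin:
  assumes W: "W > 0" and \<sigma>: "0 < \<sigma>" "\<sigma> < 1"
  shows "integrable lborel (\<lambda>t. of_real W powr (Complex \<sigma> t) / sin (of_real pi * Complex \<sigma> t))"
    and "(LINT t|lborel. of_real W powr (Complex \<sigma> t) / sin (of_real pi * Complex \<sigma> t)) = of_real (2 * W / (1 + W))"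
proof -
  define f where "f s = complex_of_real W powr s / sin (of_real pi * s)" for s
  \<comment> \<open>In this open strip the only zero of \<open>sin (\<pi> s)\<close> is
    \<open>s = 1\<close>.\<close>
  define S where "S = {s. 0 < Re s} \<inter> {s. Re s < 2}"
  have S: "open S" "convex S"
    unfolding S_def by (auto intro!: open_Int open_halfspace_Re_gt open_halfspace_Re_lt convex_Int
        convex_halfspace_Re_gt convex_halfspace_Re_lt)
  have sin_nz: "sin (of_real pi * s) \<noteq> 0" if "s \<in> S - {1}" for s
  proof
    assume "sin (of_real pi * s) = 0"
    then obtain n :: int where "of_real pi * s = of_real (of_int n * pi)"
      unfolding sin_eq_0 by blast
    then have s: "s = of_int n" by simp
    with that have "0 < real_of_int n" "real_of_int n < 2" by (auto simp: S_def)
    then have "n = 1" by linarith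
    with s that show False by simp
  qed
  have hol: "f holomorphic_on S - {1}"
    unfolding f_def using W sin_nz by (intro holomorphic_intros) auto
  have cont: "continuous_on (S - {1}) f" by (rule holomorphic_on_imp_continuous_on[OF hol])
  have sin_\<sigma>: "sin (pi * \<sigma>) > 0" using \<sigma> by (intro sin_gt_zero) auto
  have "continuous_on UNIV (\<lambda>t. f (Complex \<sigma> t))"
    by (rule continuous_on_compose2[OF cont]) (use \<sigma> in \<open>auto simp: S_def complex_eq_iff intro!: continuous_intros\<close>)
  then have int: "integrable lborel (\<lambda>t. f (Complex \<sigma> t))"
    by (rule integrable_decay)
       (unfold f_def, use sin_\<sigma> W in \<open>auto intro!: powr_over_sin_decay\<close>)
  then show "integrable lborel (\<lambda>t. of_real W powr (Complex \<sigma> t) / sin (of_real pi * Complex \<sigma> t))"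
    by (simp add: f_def)
  define I where "I = (LINT t|lborel. f (Complex \<sigma> t))"
  define J where "J T = integral {-T..T} (\<lambda>t. f (Complex \<sigma> t))" for T
  \<comment> \<open>\<open>H T\<close> is the integral over a horizontal side; it tends to zero
    because \<open>sinh (\<pi> T)\<close> grows while the power of \<open>W\<close> stays bounded on
    the strip.\<close>
  define H where "H T = contour_integral (linepath (Complex \<sigma> T) (Complex (\<sigma> + 1) T)) f" for T
  have H_bound: "norm (H T) \<le> max 1 W powr 2 / \<bar>sinh (pi * T)\<bar>" if "T \<noteq> 0" for T
  proof -
    have "norm (H T) \<le> max 1 W powr 2 / \<bar>sinh (pi * T)\<bar> * norm (Complex (\<sigma> + 1) T - Complex \<sigma> T)"
      unfolding H_def
    proof (rule contour_integral_bound_linepath)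
      have sub: "closed_segment (Complex \<sigma> T) (Complex (\<sigma> + 1) T) \<subseteq> {s. Re s \<in> {\<sigma>..\<sigma>+1} \<and> Im s = T}"
        by (subst closed_segment_same_Im) (auto simp: closed_segment_eq_real_ivl)
      then have "closed_segment (Complex \<sigma> T) (Complex (\<sigma> + 1) T) \<subseteq> S - {1}"
        using \<sigma> that by (force simp: S_def)
      then show "f contour_integrable_on linepath (Complex \<sigma> T) (Complex (\<sigma> + 1) T)"
        by (intro contour_integrable_continuous_linepath continuous_on_subset[OF cont])
      fix s assume "s \<in> closed_segment (Complex \<sigma> T) (Complex (\<sigma> + 1) T)"
      with sub have s: "Re s \<in> {\<sigma>..\<sigma>+1}" "Im s = T" by auto
      have "W powr Re s \<le> max 1 W powr Re s" using W s \<sigma> by (intro powr_mono2) auto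
      also have "\<dots> \<le> max 1 W powr 2" using s \<sigma> by (intro powr_mono) auto
      finally have "W powr Re s \<le> max 1 W powr 2" .
      moreover have "\<bar>sinh (pi * T)\<bar> \<le> norm (sin (of_real pi * s))"
        using norm_sin_ge_sinh[of "of_real pi * s"] s by simp
      ultimately show "norm (f s) \<le> max 1 W powr 2 / \<bar>sinh (pi * T)\<bar>"
        unfolding f_def norm_divide using W that by (intro frac_le) (auto simp: norm_powr_real_powr)
    qed (use W in auto)
    also have "norm (Complex (\<sigma> + 1) T - Complex \<sigma> T) = 1" by (simp add: cmod_def)
    finally show ?thesis by simp
  qed
  \<comment> \<open>Counterclockwise, the right side contributes \<open>- W\<close> times the
    integral \<open>\<i> * J T\<close> of the left side, which itself enters negatively. The value
    is \<open>2 \<pi> \<i>\<close> times the residue \<open>- W / \<pi>\<close> at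
    \<open>1\<close>.\<close>
  have rect: "H (-T) - H T - of_real (1 + W) * (\<i> * J T) = - 2 * \<i> * of_real W" if T: "T > 0" for T
  proof -
    define a1 a2 a3 a4 where "a1 = Complex \<sigma> (-T)" and "a2 = Complex (\<sigma> + 1) (-T)"
      and "a3 = Complex (\<sigma> + 1) T" and "a4 = Complex \<sigma> T"
    have rp: "rectpath a1 a3 = linepath a1 a2 +++ linepath a2 a3 +++ linepath a3 a4 +++ linepath a4 a1"
      by (simp add: rectpath_def Let_def a1_def a2_def a3_def a4_def)
    have seg: "closed_segment a1 a2 \<subseteq> S - {1}" "closed_segment a2 a3 \<subseteq> S - {1}"
      "closed_segment a4 a3 \<subseteq> S - {1}" "closed_segment a1 a4 \<subseteq> S - {1}"
      using \<sigma> T unfolding a1_def a2_def a3_def a4_def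
      by (subst closed_segment_same_Im closed_segment_same_Re;
          auto simp: S_def closed_segment_eq_real_ivl complex_eq_iff)+
    then have seg': "closed_segment a3 a4 \<subseteq> S - {1}" "closed_segment a4 a1 \<subseteq> S - {1}"
      by (simp_all add: closed_segment_commute)
    note ci = contour_integrable_continuous_linepath[OF continuous_on_subset[OF cont]]
    have "contour_integral (rectpath a1 a3) f =
        contour_integral (linepath a1 a2) f + contour_integral (linepath a2 a3) f
        + contour_integral (linepath a3 a4) f + contour_integral (linepath a4 a1) f"
      unfolding rp using ci seg seg' by (simp add: add_ac)
    also have "contour_integral (linepath a3 a4) f = - contour_integral (linepath a4 a3) f"
      using seg' by (intro contour_integral_reverse_linepath continuous_on_subset[OF cont])
    also have "contour_integral (linepath a4 a1) f = - contour_integral (linepath a1 a4) f"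
      using seg' by (intro contour_integral_reverse_linepath continuous_on_subset[OF cont])
    also have "contour_integral (linepath a1 a4) f = \<i> * J T"
      unfolding J_def by (rule contour_integral_linepath_same_Re) (use T in \<open>auto simp: a1_def a4_def\<close>)
    also have "contour_integral (linepath a2 a3) f = \<i> * integral {-T..T} (\<lambda>t. f (Complex (\<sigma> + 1) t))"
      by (rule contour_integral_linepath_same_Re) (use T in \<open>auto simp: a2_def a3_def\<close>)
    also have "(\<lambda>t. f (Complex (\<sigma> + 1) t)) = (\<lambda>t. - of_real W * f (Complex \<sigma> t))"
    proof
      fix t
      have "Complex (\<sigma> + 1) t = Complex \<sigma> t + 1" by (simp add: complex_eq_iff)
      then show "f (Complex (\<sigma> + 1) t) = - of_real W * f (Complex \<sigma> t)"
        using W by (simp add: f_def powr_add distrib_left sin_add sin_of_real cos_of_real)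
    qed
    also have "integral {-T..T} (\<lambda>t. - of_real W * f (Complex \<sigma> t)) = - of_real W * J T"
      unfolding J_def by (rule integral_mult_right)
    finally have 1: "contour_integral (rectpath a1 a3) f = H (-T) - H T - of_real (1 + W) * (\<i> * J T)"
      by (simp add: H_def a1_def a2_def a3_def a4_def algebra_simps)
    have img: "path_image (rectpath a1 a3) \<subseteq> S - {1}"
      unfolding rp using seg seg' by (simp add: path_image_join)
    have "contour_integral (rectpath a1 a3) f =
        2 * pi * \<i> * (\<Sum>p\<in>{1}. winding_number (rectpath a1 a3) p * residue f p)"
    proof (rule Residue_theorem[OF S(1) convex_connected[OF S(2)] _ hol _ _ img])
      show "\<forall>z. z \<notin> S \<longrightarrow> winding_number (rectpath a1 a3) z = 0"
        using img by (auto intro!: winding_number_zero_outside[OF _ S(2)])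
    qed auto
    also have "(\<Sum>p\<in>{1}. winding_number (rectpath a1 a3) p * residue f p) = residue f 1"
    proof -
      have "winding_number (rectpath a1 a3) 1 = 1"
        by (rule winding_number_rectpath) (use \<sigma> T in \<open>auto simp: in_box_complex_iff a1_def a3_def\<close>)
      then show ?thesis by simp
    qed
    also have "residue f 1 = of_real W powr 1 / (of_real pi * cos (of_real pi * 1))"
      unfolding f_def
    proof (rule residue_simple_pole_deriv[OF _ _ S(1) convex_connected[OF S(2)]])
      show "((\<lambda>s. sin (of_real pi * s)) has_field_derivative of_real pi * cos (of_real pi * 1)) (at 1)"
        by (auto intro!: derivative_eq_intros)
    qed (use W in \<open>auto simp: S_def cos_of_real sin_of_real intro!: holomorphic_intros\<close>)
    finally show ?thesis using 1 W by (simp add: cos_of_real)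
  qed
  have lim_H: "(\<lambda>n. max 1 W powr 2 / \<bar>sinh (pi * real n)\<bar>) \<longlonglongrightarrow> 0"
  proof (rule tendsto_divide_0[OF tendsto_const])
    have "filterlim (\<lambda>n. sinh (pi * real n)) at_top sequentially"
      unfolding sinh_field_def by real_asymp
    then have "filterlim (\<lambda>n. \<bar>sinh (pi * real n)\<bar>) at_top sequentially"
      by (rule filterlim_at_top_mono) auto
    then show "filterlim (\<lambda>n. \<bar>sinh (pi * real n)\<bar>) at_infinity sequentially"
      by (rule filterlim_at_top_imp_at_infinity)
  qed
  have H_lim: "(\<lambda>n. H (e * real n)) \<longlonglongrightarrow> 0" if "\<bar>e\<bar> = 1" for e
  proof (rule Lim_null_comparison[OF _ lim_H])
    have "norm (H (e * real n)) \<le> max 1 W powr 2 / \<bar>sinh (pi * real n)\<bar>" if "n > 0" for n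
    proof -
      have "\<bar>sinh (pi * (e * real n))\<bar> = \<bar>sinh (pi * real n)\<bar>"
        using \<open>\<bar>e\<bar> = 1\<close> by (auto simp: abs_if split: if_splits)
      then show ?thesis using H_bound[of "e * real n"] that \<open>\<bar>e\<bar> = 1\<close> by auto
    qed
    then show "\<forall>\<^sub>F n in sequentially. norm (H (e * real n)) \<le> max 1 W powr 2 / \<bar>sinh (pi * real n)\<bar>"
      by (auto intro: eventually_sequentiallyI[of 1])
  qed
  have H1: "(\<lambda>n. H (real n)) \<longlonglongrightarrow> 0" and H2: "(\<lambda>n. H (- real n)) \<longlonglongrightarrow> 0"
    using H_lim[of 1] H_lim[of "-1"] by simp_all
  have "(\<lambda>n. H (- real n) - H (real n) - of_real (1 + W) * (\<i> * J (real n)))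
        \<longlonglongrightarrow> 0 - 0 - of_real (1 + W) * (\<i> * I)"
    unfolding J_def I_def by (intro tendsto_intros H1 H2 integral_symmetric_tendsto int)
  moreover have "(\<lambda>n. H (- real n) - H (real n) - of_real (1 + W) * (\<i> * J (real n)))
        \<longlonglongrightarrow> - 2 * \<i> * of_real W"
    by (intro tendsto_eventually eventually_sequentiallyI[of 1] rect) auto
  ultimately have "0 - 0 - of_real (1 + W) * (\<i> * I) = - 2 * \<i> * of_real W"
    by (rule LIMSEQ_unique)
  then have "\<i> * (of_real (1 + W) * I) = \<i> * (2 * of_real W)" by (simp add: mult_ac)
  then have "of_real (1 + W) * I = 2 * of_real W" by (simp del: of_real_add)
  moreover have "complex_of_real (1 + W) \<noteq> 0" using W unfolding of_real_eq_0_iff by auto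
  ultimately show "(LINT t|lborel. of_real W powr (Complex \<sigma> t) / sin (of_real pi * Complex \<sigma> t)) = of_real (2 * W / (1 + W))"
    unfolding I_def f_def by (simp add: field_simps)
qed

section \<open>The closed form of the kernel\<close>

text \<open>The integrand of the kernel without its zeta factor, split off so that the terms of the
  Euler series can be integrated against it one by one.\<close>

definition kernel_weight :: "nat \<Rightarrow> real \<Rightarrow> complex \<Rightarrow> complex" where
  "kernel_weight k x s = of_real x powr (- s) /
     (2 * of_nat k * cos (of_real pi * (s + of_nat k - 1) / (2 * of_nat k)))"

context
  fixes k :: nat and x c :: real
  assumes k: "k \<ge> 1" and x: "x > 0" and c: "1 < c" "c < 2"
begin

text \<open>The real part of \<open>(s - 1) / (2 k)\<close>, the variable in which the cosine
  becomes minus the sine of \<open>\<pi>\<close> times it. It lies strictly between the zeros at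
  \<open>0\<close> and \<open>1\<close>.\<close>

definition scaled_re :: real where "scaled_re = (c - 1) / (2 * real k)"

lemma scaled_re: "0 < scaled_re" "scaled_re < 1"
proof -
  have "c - 1 < 1 * (2 * real k)" using k c by simp
  then show "scaled_re < 1" using k unfolding scaled_re_def by (subst pos_divide_less_eq) auto
qed (use k c in \<open>auto simp: scaled_re_def\<close>)

lemma cos_kernel:
  "cos (of_real pi * (Complex c t + of_nat k - 1) / (2 * of_nat k)) =
    - sin (of_real pi * Complex scaled_re (t / (2 * real k)))"
proof -
  have "of_real pi * (Complex c t + of_nat k - 1) / (2 * of_nat k) =
     of_real pi * Complex scaled_re (t / (2 * real k)) + of_real (pi / 2)"
  proof -
    have "Complex c t - 1 = 2 * of_nat k * Complex scaled_re (t / (2 * real k))"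
      using k by (simp add: complex_eq_iff scaled_re_def)
    then have "Complex c t + of_nat k - 1 = 2 * of_nat k * (Complex scaled_re (t / (2 * real k)) + 1 / 2)"
      by (simp add: algebra_simps)
    then show ?thesis using k by (simp add: field_simps)
  qed
  then show ?thesis by (simp only: cos_add cos_of_real sin_of_real) simp
qed

lemma kernel_weight_eq:
  "kernel_weight k x (Complex c t) =
     - (of_real x powr (- Complex c t)) / (2 * of_nat k * sin (of_real pi * Complex scaled_re (t / (2 * real k))))"
  unfolding kernel_weight_def cos_kernel by simp

text \<open>Since \<open>y powr (s - 1) * x powr (- s)\<close> is
  \<open>(y / x) powr (s - 1) / x\<close>, the substitution by \<open>(s - 1) / (2 k)\<close> turns
  the base into \<open>W = (y / x) ^ (2 k)\<close>, and the cosecant integral applies.\<close>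

lemma powr_kernel_weight:
  assumes y: "y > 0"
  shows "of_real y powr (Complex c t - 1) * kernel_weight k x (Complex c t) =
     - of_real (1 / (2 * real k * x)) *
      (of_real ((y / x) ^ (2 * k)) powr Complex scaled_re (t / (2 * real k))
        / sin (of_real pi * Complex scaled_re (t / (2 * real k))))"
proof -
  have s: "of_nat (2 * k) * Complex scaled_re (t / (2 * real k)) = Complex c t - 1"
    using k by (simp add: complex_eq_iff scaled_re_def)
  have "complex_of_real ((y / x) ^ (2 * k)) powr Complex scaled_re (t / (2 * real k)) =
     exp (of_nat (2 * k) * Complex scaled_re (t / (2 * real k)) * of_real (ln (y / x)))"
    using x y by (simp add: powr_def Ln_of_real ln_realpow mult_ac del: of_real_power)
  also have "\<dots> = exp ((Complex c t - 1) * of_real (ln y - ln x))"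
    unfolding s using x y by (simp add: ln_div)
  also have "\<dots> = exp ((Complex c t - 1) * of_real (ln y)) * exp (- Complex c t * of_real (ln x)) * exp (of_real (ln x))"
    by (simp add: exp_add[symmetric] algebra_simps)
  also have "\<dots> = of_real y powr (Complex c t - 1) * of_real x powr (- Complex c t) * of_real x"
    using x y by (simp add: powr_def Ln_of_real exp_of_real)
  finally show ?thesis unfolding kernel_weight_eq using x by simp
qed

text \<open>This equals \<open>- W / (x * (1 + W))\<close> with \<open>W = (y / x) ^ (2 k)\<close>.
  The summand \<open>- 1 / x\<close> is constant in \<open>y\<close>, so every difference in
  \<open>y\<close> cancels it.\<close>

definition kernel_transform :: "real \<Rightarrow> real" where
  "kernel_transform y = x ^ (2 * k - 1) / (y ^ (2 * k) + x ^ (2 * k)) - 1 / x"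

lemma
  assumes y: "y > 0"
  shows integrable_powr_kernel_weight:
      "integrable lborel (\<lambda>t. of_real y powr (Complex c t - 1) * kernel_weight k x (Complex c t))"
    and integral_powr_kernel_weight:
      "(LINT t|lborel. of_real y powr (Complex c t - 1) * kernel_weight k x (Complex c t)) = of_real (2 * kernel_transform y)"
proof -
  define W where "W = (y / x) ^ (2 * k)"
  define f where "f t = of_real W powr Complex scaled_re t / sin (of_real pi * Complex scaled_re t)" for t
  have W: "W > 0" using x y by (simp add: W_def)
  have eq: "(\<lambda>t. of_real y powr (Complex c t - 1) * kernel_weight k x (Complex c t)) =
      (\<lambda>t. - of_real (1 / (2 * real k * x)) * f (0 + 1 / (2 * real k) * t))"
    unfolding powr_kernel_weight[OF y] f_def W_def by simp
  have f: "integrable lborel f" "(LINT t|lborel. f t) = of_real (2 * W / (1 + W))"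
    using integral_powr_over_sin[OF W scaled_re] unfolding f_def by blast+
  have k': "1 / (2 * real k) \<noteq> 0" using k by simp
  from lborel_integrable_real_affine[OF f(1) k', of 0]
  show "integrable lborel (\<lambda>t. of_real y powr (Complex c t - 1) * kernel_weight k x (Complex c t))"
    unfolding eq by (rule integrable_mult_right)
  have "(LINT t|lborel. f (0 + 1 / (2 * real k) * t)) = of_real (2 * real k) * of_real (2 * W / (1 + W))"
    using lborel_integral_real_affine[OF k', of f 0] f(2) k by (simp add: scaleR_conv_of_real field_simps)
  then have "(LINT t|lborel. of_real y powr (Complex c t - 1) * kernel_weight k x (Complex c t))
     = - of_real (1 / (2 * real k * x)) * (of_real (2 * real k) * of_real (2 * W / (1 + W)))"
    unfolding eq by simp
  also have "\<dots> = of_real (- (1 / (2 * real k * x)) * (2 * real k * (2 * W / (1 + W))))"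
    by (simp only: of_real_mult of_real_minus)
  also have "- (1 / (2 * real k * x)) * (2 * real k * (2 * W / (1 + W))) = 2 * kernel_transform y"
  proof -
    have "W = y ^ (2 * k) / x ^ (2 * k)" by (simp add: W_def power_divide)
    then have "W / (1 + W) = y ^ (2 * k) / (y ^ (2 * k) + x ^ (2 * k))"
      using x add_divide_distrib[of "x ^ (2 * k)" "y ^ (2 * k)" "x ^ (2 * k)", symmetric]
      by (simp add: add.commute)
    also have "\<dots> = 1 - x ^ (2 * k) / (y ^ (2 * k) + x ^ (2 * k))"
    proof -
      have "y ^ (2 * k) + x ^ (2 * k) > 0" using x y by (intro add_pos_pos) auto
      then show ?thesis by (simp add: field_simps)
    qed
    also have "x ^ (2 * k) = x * x ^ (2 * k - 1)" using k by (simp flip: power_Suc)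
    finally have "W / (1 + W) = 1 - x * x ^ (2 * k - 1) / (y ^ (2 * k) + x * x ^ (2 * k - 1))" .
    moreover have "x ^ (2 * k) = x * x ^ (2 * k - 1)" using k by (simp flip: power_Suc)
    ultimately have "- (1 / x) * (W / (1 + W)) = kernel_transform y"
      using x by (simp add: kernel_transform_def right_diff_distrib)
    moreover have "- (1 / (2 * real k * x)) * (2 * real k * (2 * W / (1 + W))) = 2 * (- (1 / x) * (W / (1 + W)))"
      using k x by simp
    ultimately show ?thesis by simp
  qed
  finally show "(LINT t|lborel. of_real y powr (Complex c t - 1) * kernel_weight k x (Complex c t)) = of_real (2 * kernel_transform y)" .
qed

text \<open>The Pochhammer symbol is the factor in the bound for second differences, so this
  function dominates all terms of the twice transformed series up to powers of
  \<open>n + a\<close>.\<close>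

lemma integrable_weighted_quadratic:
  "integrable lborel (\<lambda>t. pochhammer (1 - Complex c t) 2 * kernel_weight k x (Complex c t))"
proof -
  define d where "d = pi / (2 * real k)"
  \<comment> \<open>Chosen so that \<open>M \<ge> 2\<close> and
    \<open>M * d ^ 4 / 24 \<ge> 2\<close>; then \<open>M * cosh (d * t)\<close> exceeds
    \<open>2 + 2 * t ^ 4\<close>, hence \<open>(1 + t ^ 2) ^ 2\<close>.\<close>
  define M where "M = 2 + 48 / d ^ 4"
  define L where "L = x powr (- c) / (2 * real k * \<bar>sin (pi * scaled_re)\<bar>)"
  have d: "d > 0" using k by (simp add: d_def)
  have sin: "sin (pi * scaled_re) > 0"
    using scaled_re by (intro sin_gt_zero) auto
  have L: "L \<ge> 0" using k by (simp add: L_def)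
  have sin_ge: "\<bar>sin (pi * scaled_re)\<bar> * cosh (d * t) \<le> norm (sin (of_real pi * Complex scaled_re (t / (2 * real k))))" for t
    using norm_sin_ge[of "of_real pi * Complex scaled_re (t / (2 * real k))"] by (simp add: d_def)
  have sin_pos: "\<bar>sin (pi * scaled_re)\<bar> * cosh (d * t) > 0" for t
    using sin by (intro mult_pos_pos) auto
  have nz: "sin (of_real pi * Complex scaled_re (t / (2 * real k))) \<noteq> 0" for t
    using sin_ge[of t] sin_pos[of t] by auto
  show ?thesis
  proof (rule integrable_decay)
    have "continuous_on UNIV (\<lambda>t. pochhammer (1 - Complex c t) 2 *
       (- (of_real x powr (- Complex c t)) / (2 * of_nat k * sin (of_real pi * Complex scaled_re (t / (2 * real k))))))"
      using k x nz by (intro continuous_intros) auto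
    then show "continuous_on UNIV (\<lambda>t. pochhammer (1 - Complex c t) 2 * kernel_weight k x (Complex c t))"
      unfolding kernel_weight_eq .
    fix t
    have "norm (1 - Complex c t) \<le> 1 + \<bar>t\<bar>" "norm (2 - Complex c t) \<le> 1 + \<bar>t\<bar>"
      using c by (auto intro!: order_trans[OF cmod_le])
    then have "norm (pochhammer (1 - Complex c t) 2) \<le> (1 + \<bar>t\<bar>) * (1 + \<bar>t\<bar>)"
      by (auto simp: numeral_2_eq_2 pochhammer_rec norm_mult intro!: mult_mono)
    also have "\<dots> \<le> 2 * (1 + t ^ 2)"
    proof -
      have "0 \<le> (1 - \<bar>t\<bar>) ^ 2" by simp
      then show ?thesis by (simp add: power2_eq_square algebra_simps)
    qed
    finally have p: "norm (pochhammer (1 - Complex c t) 2) \<le> 2 * (1 + t ^ 2)" .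
    have w: "norm (kernel_weight k x (Complex c t)) \<le> L / cosh (d * t)"
    proof -
      have "norm (kernel_weight k x (Complex c t)) =
         x powr (- c) / (2 * real k * norm (sin (of_real pi * Complex scaled_re (t / (2 * real k)))))"
        unfolding kernel_weight_eq using x by (simp add: norm_divide norm_mult norm_powr_real_powr)
      also have "\<dots> \<le> x powr (- c) / (2 * real k * (\<bar>sin (pi * scaled_re)\<bar> * cosh (d * t)))"
        using sin_ge[of t] sin_pos[of t] k
        by (intro frac_le mult_left_mono) (auto intro!: mult_pos_pos)
      also have "\<dots> = L / cosh (d * t)" by (simp add: L_def)
      finally show ?thesis .
    qed
    have "(1 + t ^ 2) ^ 2 \<le> M * cosh (d * t)"
    proof -
      have "(1 + t ^ 2) ^ 2 \<le> 2 + 2 * t ^ 4"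
      proof -
        have "0 \<le> (1 - t ^ 2) ^ 2" by simp
        then show ?thesis by (simp add: power2_eq_square power4_eq_xxxx algebra_simps)
      qed
      also have "\<dots> \<le> M * (1 + (d * t) ^ 2 / 2 + (d * t) ^ 4 / 24)"
      proof -
        have M: "M \<ge> 2" using d by (simp add: M_def)
        have "48 / d ^ 4 * ((d * t) ^ 4 / 24) = 2 * t ^ 4" using d by (simp add: power_mult_distrib)
        moreover have "48 / d ^ 4 * ((d * t) ^ 4 / 24) \<le> M * ((d * t) ^ 4 / 24)"
          by (intro mult_right_mono) (auto simp: M_def zero_le_even_power)
        moreover have "M * ((d * t) ^ 2 / 2) \<ge> 0" using M by (intro mult_nonneg_nonneg) auto
        ultimately show ?thesis using M unfolding distrib_left by linarith
      qed
      also have "\<dots> \<le> M * cosh (d * t)" using d by (intro mult_left_mono cosh_ge) (auto simp: M_def)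
      finally show ?thesis .
    qed
    then have "2 * (1 + t ^ 2) * (L / cosh (d * t)) \<le> 2 * L * M / (1 + t ^ 2)"
    proof -
      have pos: "1 + t ^ 2 > 0" by (intro add_pos_nonneg) auto
      have "(1 + t ^ 2) / cosh (d * t) \<le> M / (1 + t ^ 2)"
        using \<open>(1 + t ^ 2) ^ 2 \<le> M * cosh (d * t)\<close> pos
        by (simp add: pos_divide_le_eq pos_le_divide_eq power2_eq_square)
      from mult_left_mono[OF this, of "2 * L"] L show ?thesis by (simp add: mult_ac)
    qed
    moreover have "norm (pochhammer (1 - Complex c t) 2 * kernel_weight k x (Complex c t)) \<le> 2 * (1 + t ^ 2) * (L / cosh (d * t))"
      unfolding norm_mult by (intro mult_mono p w) auto
    ultimately show "norm (pochhammer (1 - Complex c t) 2 * kernel_weight k x (Complex c t)) \<le> (2 * L * M) / (1 + t ^ 2)"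
      by linarith
  qed
qed

section \<open>Termwise integration of the twice transformed series\<close>

lemma integrable_powr_diff_weight:
  assumes "y > 0"
  shows "integrable lborel (\<lambda>t. powr_diff m (1 - Complex c t) (of_real y) * kernel_weight k x (Complex c t))"
  using assms
proof (induction m arbitrary: y)
  case 0
  then show ?case using integrable_powr_kernel_weight by simp
next
  case (Suc m)
  from Bochner_Integration.integrable_diff[OF Suc.IH[OF Suc.prems] Suc.IH[of "y + 1"]] Suc.prems
  show ?case by (simp add: left_diff_distrib)
qed

definition weighted_diff :: "nat \<Rightarrow> real \<Rightarrow> complex" where
  "weighted_diff m y = (LINT t|lborel. powr_diff m (1 - Complex c t) (of_real y) * kernel_weight k x (Complex c t))"

lemma weighted_diff_Suc:
  assumes "y > 0"
  shows "weighted_diff (Suc m) y = weighted_diff m y - weighted_diff m (y + 1)"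
  using Bochner_Integration.integral_diff[OF integrable_powr_diff_weight[OF assms] integrable_powr_diff_weight[of "y + 1"]] assms
  by (simp add: weighted_diff_def left_diff_distrib)

lemma weighted_diff_0:
  assumes "y > 0"
  shows "weighted_diff 0 y = of_real (2 * kernel_transform y)"
  using integral_powr_kernel_weight[OF assms] by (simp add: weighted_diff_def)

text \<open>Second differences are bounded by \<open>(n + a) powr (c - 3)\<close> times a fixed
  integrable function, and \<open>c < 2\<close> makes these powers summable. The bound for first
  differences, with exponent \<open>c - 2 > -1\<close>, would not be.\<close>

lemma
  assumes a: "a > 0"
  shows integrable_weighted_tail: "integrable lborel (\<lambda>t. \<Sum>n. (-1) ^ n * powr_diff 2 (1 - Complex c t) (of_real (real n + a)) * kernel_weight k x (Complex c t))"
    and weighted_tail_sums: "(\<lambda>n. (-1) ^ n * weighted_diff 2 (real n + a)) sums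
      (LINT t|lborel. (\<Sum>n. (-1) ^ n * powr_diff 2 (1 - Complex c t) (of_real (real n + a)) * kernel_weight k x (Complex c t)))"
proof -
  let ?f = "\<lambda>n t. (-1) ^ n * powr_diff 2 (1 - Complex c t) (of_real (real n + a)) * kernel_weight k x (Complex c t)"
  have pos: "real n + a > 0" for n using a by simp
  have int: "integrable lborel (?f n)" for n
    using integrable_mult_right[OF integrable_powr_diff_weight[OF pos[of n], of 2], of "(-1) ^ n"]
    by (simp add: mult.assoc)
  let ?P = "\<lambda>t. norm (pochhammer (1 - Complex c t) 2 * kernel_weight k x (Complex c t))"
  have bound: "norm (?f n t) \<le> (real n + a) powr (c - 3) * ?P t" for n t
  proof -
    have "norm (powr_diff 2 (1 - Complex c t) (of_real (real n + a))) \<le>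
        norm (pochhammer (1 - Complex c t) 2) * (real n + a) powr (- Re (1 - Complex c t) - real 2)"
      using c pos by (intro norm_powr_diff_le) auto
    also have "- Re (1 - Complex c t) - real 2 = c - 3" by simp
    finally show ?thesis
      by (simp add: norm_mult norm_power mult.commute mult.left_commute mult_left_mono)
  qed
  have sm: "summable (\<lambda>n. (real n + a) powr (c - 3))" using c a by (intro summable_shifted_powr) auto
  have 1: "AE t in lborel. summable (\<lambda>n. norm (?f n t))"
    using bound by (intro AE_I2 summable_comparison_test'[OF summable_mult2[OF sm]]) auto
  have 2: "summable (\<lambda>n. LINT t|lborel. norm (?f n t))"
  proof (rule summable_comparison_test'[OF summable_mult2[OF sm, of "LINT t|lborel. ?P t"]])
    fix n
    have "(LINT t|lborel. norm (?f n t)) \<le> (LINT t|lborel. (real n + a) powr (c - 3) * ?P t)"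
      by (intro integral_mono bound integrable_norm int integrable_mult_right integrable_weighted_quadratic)
    then show "norm (LINT t|lborel. norm (?f n t)) \<le> (real n + a) powr (c - 3) * (LINT t|lborel. ?P t)"
      by simp
  qed
  show "integrable lborel (\<lambda>t. \<Sum>n. ?f n t)" by (rule integrable_suminf[OF int 1 2])
  have "(LINT t|lborel. ?f n t) = (-1) ^ n * weighted_diff 2 (real n + a)" for n
    by (simp add: weighted_diff_def mult.assoc)
  with sums_integral[OF int 1 2] show "(\<lambda>n. (-1) ^ n * weighted_diff 2 (real n + a)) sums (LINT t|lborel. (\<Sum>n. ?f n t))"
    by simp
qed

lemma summable_kernel_series:
  assumes a: "a > 0"
  shows "summable (\<lambda>n. 1 / ((real n + a) ^ (2 * k) + x ^ (2 * k)))"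
proof (rule summable_comparison_test'[OF summable_shifted_powr[OF a, of "- real (2 * k)"]])
  fix n
  have "real n + a > 0" using a by simp
  then show "norm (1 / ((real n + a) ^ (2 * k) + x ^ (2 * k))) \<le> (real n + a) powr (- real (2 * k))"
    using x powr_realpow[of "real n + a" "2 * k"]
    by (simp add: powr_minus inverse_eq_divide frac_le)
qed (use k in auto)

text \<open>After two Euler steps zeta is integrated term by term; the integrals are differences of
  the sequence \<open>g\<close>, up to a constant, so reading the same two steps backwards gives the
  alternating sum \<open>S\<close>. The constant \<open>- 1 / x\<close> survives only in the
  undifferenced initial term.\<close>

lemma alt_hurwitz_kernel_eq:
  assumes a: "a > 0"
  shows "alt_hurwitz_kernel c x a k = of_real (- 1 / (2 * pi * x)
     + x ^ (2 * k - 1) / pi * (\<Sum>n. (-1) ^ n / ((real n + a) ^ (2 * k) + x ^ (2 * k))))"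
proof -
  define g where "g n = x ^ (2 * k - 1) / ((real n + a) ^ (2 * k) + x ^ (2 * k))" for n
  define S where "S = (\<Sum>n. (-1) ^ n * g n)"
  define T where "T t = (\<Sum>n. (-1) ^ n * powr_diff 2 (1 - Complex c t) (of_real (real n + a)) * kernel_weight k x (Complex c t))" for t
  have pos: "real n + a > 0" for n using a by simp
  have sg: "summable g"
    using summable_mult[OF summable_kernel_series[OF a], of "x ^ (2 * k - 1)"] by (simp add: g_def[abs_def])
  have g_nonneg: "g n \<ge> 0" for n using x pos[of n] by (simp add: g_def)
  have S_sums: "(\<lambda>n. (-1) ^ n * g n) sums S"
    unfolding S_def using g_nonneg
    by (intro summable_sums summable_comparison_test'[OF sg]) (auto simp: abs_mult)
  have S_eq: "S = x ^ (2 * k - 1) * (\<Sum>n. (-1) ^ n / ((real n + a) ^ (2 * k) + x ^ (2 * k)))"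
  proof -
    have "summable (\<lambda>n. (-1) ^ n / ((real n + a) ^ (2 * k) + x ^ (2 * k)))"
    proof (rule summable_comparison_test'[OF summable_kernel_series[OF a]])
      fix n
      have "(real n + a) ^ (2 * k) + x ^ (2 * k) > 0" using x pos[of n] by (intro add_pos_pos) auto
      then show "norm ((-1) ^ n / ((real n + a) ^ (2 * k) + x ^ (2 * k))) \<le> 1 / ((real n + a) ^ (2 * k) + x ^ (2 * k))"
        by (simp add: abs_mult power_abs)
    qed
    from suminf_mult[OF this, of "x ^ (2 * k - 1)"] show ?thesis by (simp add: S_def g_def mult_ac)
  qed
  have shift: "real n + a + 1 = real (Suc n) + a" for n by simp
  have D0: "weighted_diff 0 (real n + a) = of_real (2 * (g n - 1 / x))" for n
    using weighted_diff_0[OF pos[of n]] by (simp add: kernel_transform_def g_def)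
  have D1: "weighted_diff 1 (real n + a) = of_real (2 * (g n - g (Suc n)))" for n
    unfolding One_nat_def weighted_diff_Suc[OF pos] shift D0 by (simp add: algebra_simps)
  have D2: "weighted_diff 2 (real n + a) = of_real (2 * ((g n - g (Suc n)) - (g (Suc n) - g (Suc (Suc n)))))" for n
    unfolding numeral_2_eq_2 weighted_diff_Suc[OF pos, of "Suc 0"] shift D1[unfolded One_nat_def]
    by (simp add: algebra_simps)
  \<comment> \<open>Two Euler steps turn \<open>S\<close> into
    \<open>2 * (2 * S - g 0) - (g 0 - g 1)\<close>; the outer factor \<open>2\<close> comes from
    \<open>weighted_diff\<close>.\<close>
  have tail: "(LINT t|lborel. T t) = of_real (2 * (4 * S - 2 * g 0 - (g 0 - g 1)))"
  proof -
    have g0: "(\<lambda>n. complex_of_real (g n)) \<longlonglongrightarrow> 0"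
      using tendsto_of_real[OF summable_LIMSEQ_zero[OF sg]] by simp
    then have g1: "(\<lambda>n. complex_of_real (g n) - of_real (g (Suc n))) \<longlonglongrightarrow> 0"
      using tendsto_diff[OF g0 LIMSEQ_Suc[OF g0]] by simp
    have "(\<lambda>n. (-1) ^ n * complex_of_real (g n)) sums of_real S"
      using sums_of_real[OF S_sums, where ?'a = complex] by simp
    from alternating_diff_sums[OF g1 alternating_diff_sums[OF g0 this]]
    have "(\<lambda>n. 2 * ((-1) ^ n * ((complex_of_real (g n) - of_real (g (Suc n))) - (of_real (g (Suc n)) - of_real (g (Suc (Suc n)))))))
        sums (2 * (2 * (2 * of_real S - of_real (g 0)) - (of_real (g 0) - of_real (g (Suc 0)))))"
      by (rule sums_mult)
    moreover have "(\<lambda>n. (-1) ^ n * weighted_diff 2 (real n + a)) sums (LINT t|lborel. T t)"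
      unfolding T_def by (rule weighted_tail_sums[OF a])
    then have "(\<lambda>n. 2 * ((-1) ^ n * ((complex_of_real (g n) - of_real (g (Suc n))) - (of_real (g (Suc n)) - of_real (g (Suc (Suc n)))))))
        sums (LINT t|lborel. T t)"
      unfolding D2 by (simp add: algebra_simps)
    ultimately show ?thesis by (auto dest: sums_unique2 simp: algebra_simps)
  qed
  have integrand: "zeta_E (1 - Complex c t) a * kernel_weight k x (Complex c t) =
      powr_diff 0 (1 - Complex c t) (of_real a) * kernel_weight k x (Complex c t) / 2
      + powr_diff 1 (1 - Complex c t) (of_real a) * kernel_weight k x (Complex c t) / 4 + T t / 4" for t
  proof -
    let ?z = "1 - Complex c t"
    have z: "Re ?z > 1 - real 2" using c by simp
    have "T t = (\<Sum>n. (-1) ^ n * powr_diff 2 ?z (of_real (real n + a))) * kernel_weight k x (Complex c t)"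
      unfolding T_def by (rule suminf_mult2[OF summable_powr_diff[OF a z], symmetric])
    then show ?thesis
      unfolding zeta_E_eq_euler_cont[OF a z] euler_cont_def[OF a]
      by (simp add: numeral_2_eq_2 distrib_right add_divide_distrib del: powr_diff.simps)
  qed
  have T: "integrable lborel T" unfolding T_def by (rule integrable_weighted_tail[OF a])
  have "(LINT t|lborel. zeta_E (1 - Complex c t) a * kernel_weight k x (Complex c t)) =
      weighted_diff 0 a / 2 + weighted_diff 1 a / 4 + (LINT t|lborel. T t) / 4"
    unfolding integrand
    using integrable_powr_diff_weight[OF a, of 0] integrable_powr_diff_weight[OF a, of 1] T
    by (simp add: weighted_diff_def del: powr_diff.simps)
  also have "\<dots> = of_real (2 * S - 1 / x)"
  proof -
    have w: "weighted_diff 0 a = of_real (2 * (g 0 - 1 / x))" "weighted_diff 1 a = of_real (2 * (g 0 - g 1))"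
      using D0[of 0] D1[of 0] by simp_all
    show ?thesis unfolding w tail by (simp add: field_simps)
  qed
  finally have main: "(LINT t|lborel. zeta_E (1 - Complex c t) a * kernel_weight k x (Complex c t)) = of_real (2 * S - 1 / x)" .
  have "alt_hurwitz_kernel c x a k = 1 / (2 * of_real pi * \<i>) *
      (LINT t|lborel. zeta_E (1 - Complex c t) a * kernel_weight k x (Complex c t) * \<i>)"
    unfolding alt_hurwitz_kernel_def vertical_line_integral_def kernel_weight_def by simp
  also have "\<dots> = of_real ((2 * S - 1 / x) / (2 * pi))"
    by (simp add: main)
  also have "(2 * S - 1 / x) / (2 * pi) = - 1 / (2 * pi * x) + S / pi"
    using x by (simp add: field_simps)
  finally show ?thesis by (simp add: S_eq)
qed

end

section \<open>Reciprocity for the double series\<close>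

text \<open>Domination by a product of absolutely summable sequences gives absolute summability over
  pairs. The iterated sum is then an unordered sum, in which rows and columns may be
  exchanged.\<close>

lemma
  fixes f :: "nat \<times> nat \<Rightarrow> real"
  assumes u: "summable (\<lambda>n. \<bar>u n\<bar>)" and v: "summable (\<lambda>n. \<bar>v n\<bar>)"
    and f: "\<And>n m. \<bar>f (n, m)\<bar> \<le> \<bar>u n\<bar> * \<bar>v m\<bar>"
  shows dominated_double_summable: "summable (\<lambda>n. \<Sum>m. f (n, m))"
    and dominated_double_has_sum: "(f has_sum (\<Sum>n. \<Sum>m. f (n, m))) UNIV"
proof -
  have hs: "(g has_sum suminf g) UNIV" if "summable (\<lambda>n. \<bar>g n\<bar>)" for g :: "nat \<Rightarrow> real"
    using that by (intro norm_summable_imp_has_sum summable_sums) (auto intro: summable_rabs_cancel)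
  have "(\<lambda>p. \<bar>u (fst p)\<bar> * \<bar>v (snd p)\<bar>) summable_on UNIV \<times> UNIV"
  proof (rule summable_on_SigmaI)
    show "((\<lambda>y. \<bar>u (fst (x, y))\<bar> * \<bar>v (snd (x, y))\<bar>) has_sum \<bar>u x\<bar> * (\<Sum>n. \<bar>v n\<bar>)) UNIV" for x
      using hs[of "\<lambda>n. \<bar>v n\<bar>"] v by (simp add: has_sum_cmult_right)
    show "(\<lambda>x. \<bar>u x\<bar> * (\<Sum>n. \<bar>v n\<bar>)) summable_on UNIV"
      using hs[of "\<lambda>n. \<bar>u n\<bar>"] u by (intro summable_on_cmult_left has_sum_imp_summable) auto
  qed auto
  then have "(\<lambda>p. norm (f p)) summable_on UNIV \<times> UNIV"
    by (rule Infinite_Sum.abs_summable_on_comparison_test') (use f in auto)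
  then have sf: "f summable_on UNIV" by (simp add: abs_summable_summable)
  have inner: "((\<lambda>m. f (n, m)) has_sum (\<Sum>m. f (n, m))) UNIV" for n
    using f by (intro hs summable_comparison_test'[OF summable_mult[OF v, of "\<bar>u n\<bar>"]]) auto
  obtain S where S: "(f has_sum S) (UNIV \<times> UNIV)" using sf by (auto simp: summable_on_def)
  then have outer: "((\<lambda>n. \<Sum>m. f (n, m)) has_sum S) UNIV"
    by (rule has_sum_SigmaD) (use inner in auto)
  from has_sum_imp_sums[OF this] show "summable (\<lambda>n. \<Sum>m. f (n, m))" by (simp add: sums_iff)
  from has_sum_imp_sums[OF outer] S show "(f has_sum (\<Sum>n. \<Sum>m. f (n, m))) UNIV" by (simp add: sums_iff)
qed

lemma has_sum_sum_nat:
  fixes f :: "nat \<Rightarrow> 'a \<Rightarrow> real"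
  assumes "\<And>j. j < N \<Longrightarrow> (f j has_sum S j) X"
  shows "((\<lambda>x. \<Sum>j<N. f j x) has_sum (\<Sum>j<N. S j)) X"
  using assms by (induction N) (auto intro!: has_sum_add)

lemma has_sum_product_nat:
  fixes u v :: "nat \<Rightarrow> real"
  assumes "summable (\<lambda>n. \<bar>u n\<bar>)" and "summable (\<lambda>n. \<bar>v n\<bar>)"
  shows "((\<lambda>(n, m). u n * v m) has_sum (suminf u * suminf v)) UNIV"
proof -
  have "((\<lambda>(n, m). u n * v m) has_sum (\<Sum>n. \<Sum>m. (\<lambda>(n, m). u n * v m) (n, m))) UNIV"
    using assms by (rule dominated_double_has_sum) (auto simp: abs_mult)
  moreover have "(\<Sum>n. \<Sum>m. u n * v m) = suminf u * suminf v"
    using assms by (simp add: suminf_mult suminf_mult2[symmetric] summable_rabs_cancel)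
  ultimately show ?thesis by simp
qed

text \<open>Iterates the partial fraction
  \<open>1 / (x * (y + q * x)) = 1 / (y * x) - q / (y * (y + q * x))\<close>: each use moves one
  power from \<open>x\<close> to \<open>y\<close> and leaves a term in which the variables are
  separated.\<close>

lemma inverse_power_add_expand:
  fixes x y q :: real
  assumes "x > 0" "y > 0" "q > 0"
  shows "1 / (x ^ N * (y + q * x)) =
    (- q) ^ N / (y ^ N * (y + q * x)) + (\<Sum>j<N. (- q) ^ j / (y ^ Suc j * x ^ (N - j)))"
proof (induction N)
  case (Suc N)
  have nz: "y + q * x \<noteq> 0" using assms by (metis add_pos_pos less_irrefl mult_pos_pos)
  have step: "(- q) ^ N / (x * (y ^ N * (y + q * x))) =
      (- q) ^ Suc N / (y ^ Suc N * (y + q * x)) + (- q) ^ N / (y ^ Suc N * x)"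
  proof -
    have "1 / (x * (y + q * x)) = - q / (y * (y + q * x)) + 1 / (y * x)"
    proof -
      define D where "D = y + q * x"
      have "q = (D - y) / x" "D \<noteq> 0" using assms nz by (auto simp: D_def)
      then show ?thesis unfolding D_def[symmetric] using assms by (simp add: field_simps)
    qed
    then have "(- q) ^ N / y ^ N * (1 / (x * (y + q * x))) =
        (- q) ^ N / y ^ N * (- q / (y * (y + q * x)) + 1 / (y * x))" by simp
    then show ?thesis
      by (simp only: distrib_left[of "(- q) ^ N / y ^ N"] times_divide_times_eq mult_1_right power_Suc mult_ac)
  qed
  have "1 / (x ^ Suc N * (y + q * x)) = (1 / (x ^ N * (y + q * x))) / x" by simp
  also have "\<dots> = (- q) ^ N / (x * (y ^ N * (y + q * x))) + (\<Sum>j<N. (- q) ^ j / (y ^ Suc j * x ^ (N - j))) / x"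
    unfolding Suc.IH by (simp add: add_divide_distrib mult.commute)
  also have "(\<Sum>j<N. (- q) ^ j / (y ^ Suc j * x ^ (N - j))) / x = (\<Sum>j<N. (- q) ^ j / (y ^ Suc j * x ^ (Suc N - j)))"
    unfolding sum_divide_distrib by (intro sum.cong) (auto simp: Suc_diff_le)
  finally show ?case using step by simp
qed simp

section \<open>The double series and the exchange of its indices\<close>

context
  fixes A :: "nat \<Rightarrow> real"
  assumes A: "\<And>n. A n > 0" and summable_A: "summable (\<lambda>n. 1 / A n)"
begin

text \<open>In the application \<open>q * A n\<close> is the \<open>2 k\<close>-th power of the
  kernel argument belonging to \<open>n + a\<close>, so the inner series is the one in the closed
  form of the kernel.\<close>

definition double_series :: "real \<Rightarrow> nat \<Rightarrow> real" where
  "double_series q N = (\<Sum>n. (-1) ^ n / A n ^ N * (\<Sum>m. (-1) ^ m / (A m + q * A n)))"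

definition double_term :: "real \<Rightarrow> nat \<Rightarrow> nat \<times> nat \<Rightarrow> real" where
  "double_term q N = (\<lambda>(n, m). (-1) ^ n / A n ^ N * ((-1) ^ m / (A m + q * A n)))"

lemma summable_inverse_power:
  assumes "N \<ge> 1"
  shows "summable (\<lambda>n. \<bar>(-1) ^ n / A n ^ N\<bar>)"
proof (rule summable_comparison_test_ev[OF _ summable_A])
  have "(\<lambda>n. 1 / A n) \<longlonglongrightarrow> 0" by (rule summable_LIMSEQ_zero[OF summable_A])
  then have "\<forall>\<^sub>F n in sequentially. 1 / A n < 1" by (rule order_tendstoD) simp
  then show "\<forall>\<^sub>F n in sequentially. norm \<bar>(-1) ^ n / A n ^ N\<bar> \<le> 1 / A n"
  proof eventually_elim
    case (elim n)
    then have "(1 / A n) ^ N \<le> (1 / A n) ^ 1"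
      using A[of n] assms by (intro power_decreasing) auto
    then show ?case using A[of n] by (simp add: abs_mult power_abs power_divide)
  qed
qed

lemma double_term_le:
  assumes "q > 0"
  shows "\<bar>double_term q N (n, m)\<bar> \<le> \<bar>(-1) ^ n / A n ^ N\<bar> * \<bar>(-1) ^ m / A m ^ 1\<bar>"
proof -
  have "1 / (A m + q * A n) \<le> 1 / A m" using A[of n] A[of m] assms by (intro frac_le) auto
  moreover have "A m + q * A n > 0" using A assms by (intro add_pos_pos mult_pos_pos) auto
  ultimately show ?thesis using A[of n] A[of m]
    using mult_left_mono[of "1 / (A m + q * A n)" "1 / A m" "1 / A n ^ N"]
    unfolding double_term_def by (simp add: abs_mult power_abs)
qed

lemma summable_inner:
  assumes "q > 0"
  shows "summable (\<lambda>m. (-1) ^ m / (A m + q * A n))"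
proof (rule summable_comparison_test'[OF summable_A])
  fix m
  have "1 / (A m + q * A n) \<le> 1 / A m" using A[of n] A[of m] assms by (intro frac_le) auto
  moreover have "A m + q * A n > 0" using A assms by (intro add_pos_pos mult_pos_pos) auto
  ultimately show "norm ((-1) ^ m / (A m + q * A n)) \<le> 1 / A m" by (simp add: abs_mult power_abs)
qed

lemma suminf_double_term:
  assumes "q > 0"
  shows "(\<Sum>m. double_term q N (n, m)) = (-1) ^ n / A n ^ N * (\<Sum>m. (-1) ^ m / (A m + q * A n))"
  using summable_inner[OF assms, of n] unfolding double_term_def by (simp only: prod.case suminf_mult)

lemma
  assumes "q > 0" "N \<ge> 1"
  shows double_series_summable: "summable (\<lambda>n. (-1) ^ n / A n ^ N * (\<Sum>m. (-1) ^ m / (A m + q * A n)))"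
    and double_series_has_sum: "(double_term q N has_sum double_series q N) UNIV"
proof -
  note prems = summable_inverse_power[OF assms(2)] summable_inverse_power[OF order_refl] double_term_le[OF assms(1)]
  show "summable (\<lambda>n. (-1) ^ n / A n ^ N * (\<Sum>m. (-1) ^ m / (A m + q * A n)))"
    using dominated_double_summable[OF prems] unfolding suminf_double_term[OF assms(1)] .
  show "(double_term q N has_sum double_series q N) UNIV"
    using dominated_double_has_sum[OF prems] unfolding suminf_double_term[OF assms(1)] double_series_def .
qed

text \<open>Because \<open>A n + A m / q = (A m + q * A n) / q\<close>, the remainder of the partial
  fraction expansion is a multiple of the term for \<open>1 / q\<close> with indices exchanged. The
  other terms factor into products of single series, all with exponent at least one and hence
  absolutely convergent.\<close>

lemma double_series_reciprocity:
  assumes q: "q > 0" and N: "N \<ge> 1"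
  shows "double_series q N = (- q) ^ N / q * double_series (1 / q) N
    + (\<Sum>j<N. (- q) ^ j * ((\<Sum>n. (-1) ^ n / A n ^ (N - j)) * (\<Sum>n. (-1) ^ n / A n ^ Suc j)))"
proof -
  have "((\<lambda>(n, m). double_term (1 / q) N (m, n)) has_sum double_series (1 / q) N) UNIV"
    using has_sum_swap[where f = "double_term (1 / q) N" and A = UNIV and B = UNIV] double_series_has_sum[of "1 / q" N] q N by simp
  then have 1: "((\<lambda>p. (- q) ^ N / q * (case p of (n, m) \<Rightarrow> double_term (1 / q) N (m, n)))
      has_sum ((- q) ^ N / q * double_series (1 / q) N)) UNIV"
    by (rule has_sum_cmult_right)
  have 2: "((\<lambda>p. \<Sum>j<N. (- q) ^ j * (case p of (n, m) \<Rightarrow> (-1) ^ n / A n ^ (N - j) * ((-1) ^ m / A m ^ Suc j)))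
     has_sum (\<Sum>j<N. (- q) ^ j * ((\<Sum>n. (-1) ^ n / A n ^ (N - j)) * (\<Sum>n. (-1) ^ n / A n ^ Suc j)))) UNIV"
    by (intro has_sum_sum_nat has_sum_cmult_right has_sum_product_nat summable_inverse_power) auto
  have expand: "double_term q N (n, m) = (- q) ^ N / q * double_term (1 / q) N (m, n)
     + (\<Sum>j<N. (- q) ^ j * ((-1) ^ n / A n ^ (N - j) * ((-1) ^ m / A m ^ Suc j)))" for n m
  proof -
    have nz: "A m + q * A n > 0" using A q by (intro add_pos_pos mult_pos_pos) auto
    have "A n + 1 / q * A m = (A m + q * A n) / q" using q by (simp add: field_simps)
    then have *: "double_term (1 / q) N (m, n) = (-1) ^ n * (-1) ^ m * q / (A m ^ N * (A m + q * A n))"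
      by (simp add: double_term_def mult_ac)
    have "double_term q N (n, m) = (-1) ^ n * (-1) ^ m * (1 / (A n ^ N * (A m + q * A n)))"
      by (simp add: double_term_def)
    also have "\<dots> = (-1) ^ n * (-1) ^ m * ((- q) ^ N / (A m ^ N * (A m + q * A n)))
       + (\<Sum>j<N. (-1) ^ n * (-1) ^ m * ((- q) ^ j / (A m ^ Suc j * A n ^ (N - j))))"
      unfolding inverse_power_add_expand[OF A A q] distrib_left[of "(-1) ^ n * (-1) ^ m"] sum_distrib_left ..
    also have "(-1) ^ n * (-1) ^ m * ((- q) ^ N / (A m ^ N * (A m + q * A n))) = (- q) ^ N / q * double_term (1 / q) N (m, n)"
      unfolding * using q by simp
    also have "(\<Sum>j<N. (-1) ^ n * (-1) ^ m * ((- q) ^ j / (A m ^ Suc j * A n ^ (N - j)))) =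
        (\<Sum>j<N. (- q) ^ j * ((-1) ^ n / A n ^ (N - j) * ((-1) ^ m / A m ^ Suc j)))"
      by (intro sum.cong refl) (simp only: times_divide_times_eq times_divide_eq_right divide_divide_eq_left mult_ac)
    finally show ?thesis .
  qed
  have "double_term q N = (\<lambda>p. (- q) ^ N / q * (case p of (n, m) \<Rightarrow> double_term (1 / q) N (m, n))
     + (\<Sum>j<N. (- q) ^ j * (case p of (n, m) \<Rightarrow> (-1) ^ n / A n ^ (N - j) * ((-1) ^ m / A m ^ Suc j))))"
  proof
    fix p :: "nat \<times> nat"
    obtain n m where p: "p = (n, m)" by (cases p)
    show "double_term q N p = (- q) ^ N / q * (case p of (n, m) \<Rightarrow> double_term (1 / q) N (m, n))
     + (\<Sum>j<N. (- q) ^ j * (case p of (n, m) \<Rightarrow> (-1) ^ n / A n ^ (N - j) * ((-1) ^ m / A m ^ Suc j)))"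
      unfolding p prod.case by (rule expand)
  qed
  from has_sum_add[OF 1 2, folded this] show ?thesis
    by (rule has_sum_unique[OF double_series_has_sum[OF q N]])
qed

end

section \<open>The transformation formula\<close>

text \<open>Multiplies the reciprocity \<open>S\<close> by
  \<open>\<beta> ^ (k * (N + 1)) * q / (\<alpha> * \<beta>)\<close>. Here \<open>z\<close> stands
  for the zeta values; the end terms of the sum match the two contributions of
  \<open>- 1 / (2 \<pi> x)\<close> since \<open>z 0 = 1 / 2\<close>.\<close>

lemma reciprocity_arithmetic:
  fixes \<alpha> \<beta> q S S' :: real and z :: "nat \<Rightarrow> real"
  assumes pos: "\<alpha> > 0" "\<beta> > 0" and k: "k \<ge> 1" and q: "q = \<alpha> ^ k / \<beta> ^ k" and z0: "z 0 = 1 / 2"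
    and S: "S = (- q) ^ N / q * S' + (\<Sum>j<N. (- q) ^ j * (z (N - j) * z (Suc j)))"
  shows "\<beta> ^ (k * (N + 1) - 1) * (- (1 / (2 * \<alpha>)) * z (N + 1) + q / \<alpha> * S) =
    (-1) ^ N * \<alpha> ^ (k * (N + 1) - 1) * (- (1 / (2 * \<beta>)) * z (N + 1) + 1 / (q * \<beta>) * S')
    + (\<Sum>p=0..N+1. (-1) ^ (p + 1) * z p * z (N + 1 - p) * (\<alpha> ^ (k * p) / \<alpha>) * (\<beta> ^ (k * (N + 1 - p)) / \<beta>))"
proof -
  define u v where "u = \<alpha> ^ k" and "v = \<beta> ^ k"
  have uv: "u > 0" "v > 0" and q': "q = u / v" using pos q by (auto simp: u_def v_def)
  \<comment> \<open>As \<open>k \<ge> 1\<close>, the subtraction in the exponent is not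
    truncated.\<close>
  have pm: "t ^ (k * (N + 1) - 1) = (t ^ k) ^ (N + 1) / t" if "t > 0" for t :: real
  proof -
    have "Suc (k * (N + 1) - 1) = k * (N + 1)" using k by simp
    then have "t * t ^ (k * (N + 1) - 1) = (t ^ k) ^ (N + 1)" by (metis power_Suc power_mult)
    then show ?thesis using that by (simp add: field_simps)
  qed
  \<comment> \<open>Separates the end terms \<open>p = 0\<close> and \<open>p = N + 1\<close>; the
    others are \<open>p = j + 1\<close> for the index \<open>j\<close> of the geometric sum.\<close>
  have N1: "{0..N+1} = insert 0 (insert (N + 1) (Suc ` {..<N}))"
  proof -
    have "{0..N+1} = insert 0 (Suc ` {..N})" by (simp add: atLeast0AtMost atMost_Suc_eq_insert_0)
    also have "{..N} = insert N {..<N}" by auto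
    finally show ?thesis by (simp add: insert_commute)
  qed
  have "(\<Sum>p=0..N+1. (-1) ^ (p + 1) * z p * z (N + 1 - p) * (u ^ p / \<alpha>) * (v ^ (N + 1 - p) / \<beta>))
     = - z 0 * z (N + 1) / \<alpha> * (v ^ (N + 1) / \<beta>)
       + ((-1) ^ N * z (N + 1) * z 0 * (u ^ (N + 1) / \<alpha>) / \<beta>
       + (\<Sum>j<N. (-1) ^ j * z (Suc j) * z (N - j) * (u ^ Suc j / \<alpha>) * (v ^ (N - j) / \<beta>)))"
    unfolding N1 by (subst sum.insert, simp, force, subst sum.insert, simp, force, subst sum.reindex) (simp_all add: o_def)
  also have "(\<Sum>j<N. (-1) ^ j * z (Suc j) * z (N - j) * (u ^ Suc j / \<alpha>) * (v ^ (N - j) / \<beta>))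
      = v ^ (N + 1) / \<beta> * (q / \<alpha> * (\<Sum>j<N. (- q) ^ j * (z (N - j) * z (Suc j))))"
    unfolding sum_distrib_left
  proof (intro sum.cong refl)
    fix j assume "j \<in> {..<N}"
    then have "v ^ (N + 1) = v ^ (N - j) * v ^ Suc j" unfolding power_add[symmetric] by simp
    moreover have "(- q) ^ j * q * v ^ Suc j = (-1) ^ j * u ^ Suc j"
    proof -
      have "(- q) ^ j = (-1) ^ j * q ^ j" by (metis mult_minus1 power_mult_distrib)
      moreover have "q ^ Suc j * v ^ Suc j = u ^ Suc j" using uv unfolding power_mult_distrib[symmetric] q' by simp
      ultimately show ?thesis by (simp add: mult_ac)
    qed
    ultimately have "v ^ (N + 1) * ((- q) ^ j * q) = (-1) ^ j * u ^ Suc j * v ^ (N - j)"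
      by (metis mult.assoc mult.commute)
    then have "v ^ (N + 1) * ((- q) ^ j * q) * (z (N - j) * z (Suc j)) / (\<alpha> * \<beta>)
       = (-1) ^ j * u ^ Suc j * v ^ (N - j) * (z (N - j) * z (Suc j)) / (\<alpha> * \<beta>)" by simp
    then show "(-1) ^ j * z (Suc j) * z (N - j) * (u ^ Suc j / \<alpha>) * (v ^ (N - j) / \<beta>)
       = v ^ (N + 1) / \<beta> * (q / \<alpha> * ((- q) ^ j * (z (N - j) * z (Suc j))))"
      by (simp only: times_divide_times_eq times_divide_eq_right times_divide_eq_left divide_divide_eq_left mult_ac)
  qed
  also have "(\<Sum>j<N. (- q) ^ j * (z (N - j) * z (Suc j))) = S - (- q) ^ N / q * S'" using S by simp
  finally have sum: "(\<Sum>p=0..N+1. (-1) ^ (p + 1) * z p * z (N + 1 - p) * (u ^ p / \<alpha>) * (v ^ (N + 1 - p) / \<beta>))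
     = - z 0 * z (N + 1) / \<alpha> * (v ^ (N + 1) / \<beta>)
       + ((-1) ^ N * z (N + 1) * z 0 * (u ^ (N + 1) / \<alpha>) / \<beta>
       + v ^ (N + 1) / \<beta> * (q / \<alpha> * (S - (- q) ^ N / q * S')))" .
  \<comment> \<open>Rests on \<open>v ^ (N + 1) * q ^ N = u ^ (N + 1) / q\<close>, which exchanges
    the power of \<open>\<beta>\<close> for that of \<open>\<alpha>\<close>.\<close>
  have swap: "v ^ (N + 1) / \<beta> * (q / \<alpha> * ((- q) ^ N / q * S')) = (-1) ^ N * (u ^ (N + 1) / \<alpha>) * (1 / (q * \<beta>) * S')"
  proof -
    have "(- q) ^ N = (-1) ^ N * q ^ N" by (metis mult_minus1 power_mult_distrib)
    moreover have "q ^ N * v ^ N = u ^ N" using uv unfolding power_mult_distrib[symmetric] q' by simp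
    ultimately have "v ^ (N + 1) * (- q) ^ N = (-1) ^ N * u ^ N * v" by (simp add: mult_ac)
    also have "\<dots> = (-1) ^ N * u ^ (N + 1) / q" using uv by (simp add: q')
    finally have *: "v ^ (N + 1) * (- q) ^ N = (-1) ^ N * u ^ (N + 1) / q" .
    have "v ^ (N + 1) / \<beta> * (q / \<alpha> * ((- q) ^ N / q * S')) = v ^ (N + 1) * (- q) ^ N * S' / (\<alpha> * \<beta>)"
      using uv q' by (simp add: mult_ac)
    then show ?thesis unfolding * by simp
  qed
  have "(\<Sum>p=0..N+1. (-1) ^ (p + 1) * z p * z (N + 1 - p) * (\<alpha> ^ (k * p) / \<alpha>) * (\<beta> ^ (k * (N + 1 - p)) / \<beta>))
     = (\<Sum>p=0..N+1. (-1) ^ (p + 1) * z p * z (N + 1 - p) * (u ^ p / \<alpha>) * (v ^ (N + 1 - p) / \<beta>))"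
    unfolding u_def v_def power_mult ..
  then show ?thesis
    unfolding sum pm[OF pos(1)] pm[OF pos(2)] u_def[symmetric] v_def[symmetric] z0
    using swap by (simp add: algebra_simps)
qed

text \<open>With \<open>y = n + a\<close> and \<open>x = \<gamma> * y / \<pi>\<close>, both
  exponents that are lowered by one are restored through division by \<open>x\<close> and
  \<open>y\<close>, and \<open>y / (\<pi> * x) = 1 / \<gamma>\<close> removes the remaining
  dependence on \<open>n\<close>.\<close>

lemma scaled_kernel_term:
  assumes \<gamma>: "\<gamma> > 0" and k: "k \<ge> 1" and a: "a > 0" and c: "1 < c" "c < 2"
  defines "A \<equiv> \<lambda>n. (real n + a) ^ (2 * k)" and "q \<equiv> (\<gamma> / pi) ^ (2 * k)"
  shows "(-1) ^ n * scaled_alt_hurwitz_kernel c \<gamma> (real n + a) a k / of_real (real n + a) ^ (2 * k * (N + 1) - 1)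
    = of_real (- (1 / (2 * \<gamma>)) * ((-1) ^ n / A n ^ (N + 1))
        + q / \<gamma> * ((-1) ^ n / A n ^ N * (\<Sum>m. (-1) ^ m / (A m + q * A n))))"
proof -
  define y where "y = real n + a"
  define x where "x = \<gamma> * y / pi"
  define H where "H = (\<Sum>m. (-1) ^ m / (A m + q * A n))"
  have y: "y > 0" and x: "x > 0" using a \<gamma> by (auto simp: y_def x_def)
  have An: "A n = y ^ (2 * k)" by (simp add: A_def y_def)
  have xk: "x ^ (2 * k) = q * A n" by (simp add: x_def q_def An power_mult_distrib power_divide)
  have xk1: "x ^ (2 * k - 1) = q * A n / x"
  proof -
    have "x * x ^ (2 * k - 1) = x ^ (2 * k)" using k by (simp flip: power_Suc)
    then show ?thesis using x unfolding xk by (simp add: field_simps)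
  qed
  have yk: "y ^ (2 * k * (N + 1) - 1) = A n ^ (N + 1) / y"
  proof -
    have "Suc (2 * k * (N + 1) - 1) = 2 * k * (N + 1)" using k by simp
    then have "y * y ^ (2 * k * (N + 1) - 1) = (y ^ (2 * k)) ^ (N + 1)" by (metis power_Suc power_mult)
    then show ?thesis using y by (simp add: An field_simps)
  qed
  have "scaled_alt_hurwitz_kernel c \<gamma> y a k = of_real (- 1 / (2 * pi * x) + x ^ (2 * k - 1) / pi * H)"
    unfolding scaled_alt_hurwitz_kernel_def x_def[symmetric] alt_hurwitz_kernel_eq[OF k x c a] H_def
    by (simp add: xk A_def)
  then have "(-1) ^ n * scaled_alt_hurwitz_kernel c \<gamma> y a k / of_real y ^ (2 * k * (N + 1) - 1)
     = of_real ((-1) ^ n * (- 1 / (2 * pi * x) + x ^ (2 * k - 1) / pi * H) / y ^ (2 * k * (N + 1) - 1))"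
    by simp
  also have "(-1) ^ n * (- 1 / (2 * pi * x) + x ^ (2 * k - 1) / pi * H) / y ^ (2 * k * (N + 1) - 1)
     = - (1 / (2 * \<gamma>)) * ((-1) ^ n / A n ^ (N + 1)) + q / \<gamma> * ((-1) ^ n / A n ^ N * H)"
  proof -
    have "A n > 0" using y by (simp add: An)
    then show ?thesis unfolding xk1 yk using y \<gamma> by (simp add: x_def field_simps)
  qed
  finally show ?thesis unfolding y_def H_def .
qed

text \<open>Summability is asserted as well, since \<open>suminf\<close> carries no information for
  a divergent series. Integer powers are used because the exponent of \<open>\<alpha>\<close> is
  \<open>-1\<close> at \<open>p = 0\<close> and that of \<open>\<beta>\<close> is \<open>-1\<close>
  at \<open>p = N + 1\<close>.\<close>

theorem corollary1p22:
  fixes \<alpha> \<beta> a c :: real and k N :: nat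
  assumes "\<alpha> > 0" and "\<beta> > 0" and "\<alpha> * \<beta> = pi ^ 2"
    and "k \<ge> 1" and "N \<ge> 1" and "a > 0"
    and "1 < c" and "c < 2"
  shows "(\<forall>\<gamma>\<in>{\<alpha>, \<beta>}. summable (\<lambda>n. (-1) ^ n * scaled_alt_hurwitz_kernel c \<gamma> (real n + a) a k
                         / of_real (real n + a) ^ (2 * k * (N + 1) - 1))) \<and>
         of_real \<beta> ^ (k * (N + 1) - 1) *
           (\<Sum>n. (-1) ^ n * scaled_alt_hurwitz_kernel c \<alpha> (real n + a) a k
                 / of_real (real n + a) ^ (2 * k * (N + 1) - 1))
         = (-1) ^ N * of_real \<alpha> ^ (k * (N + 1) - 1) *
             (\<Sum>n. (-1) ^ n * scaled_alt_hurwitz_kernel c \<beta> (real n + a) a k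
                   / of_real (real n + a) ^ (2 * k * (N + 1) - 1))
           + (\<Sum>p=0..N+1. (-1) ^ (p + 1)
                * zeta_E (of_nat (2 * k * p)) a * zeta_E (of_nat (2 * k * (N + 1 - p))) a
                * of_real \<alpha> powi (int k * int p - 1)
                * of_real \<beta> powi (int k * (int N + 1 - int p) - 1))"
proof -
  define A where "A n = (real n + a) ^ (2 * k)" for n
  \<comment> \<open>The zeta values as reals. At \<open>p = 0\<close> the series diverges, so the
    continued value \<open>1 / 2\<close> is put in by hand.\<close>
  define z where "z p = (if p = 0 then 1 / 2 else \<Sum>n. (-1) ^ n / A n ^ p)" for p
  define q where "q \<gamma> = (\<gamma> / pi) ^ (2 * k)" for \<gamma>
  have A_pos: "A n > 0" for n using assms by (simp add: A_def)
  have A_sum: "summable (\<lambda>n. 1 / A n)"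
  proof (rule summable_cong[THEN iffD1])
    show "summable (\<lambda>n. (real n + a) powr (- real (2 * k)))"
      using assms by (intro summable_shifted_powr) auto
    show "\<forall>\<^sub>F n in sequentially. (real n + a) powr (- real (2 * k)) = 1 / A n"
    proof (intro always_eventually allI)
      fix n
      have "real n + a > 0" using assms by simp
      then show "(real n + a) powr (- real (2 * k)) = 1 / A n"
        using powr_realpow[of "real n + a" "2 * k"] by (simp add: A_def powr_minus inverse_eq_divide)
    qed
  qed
  have kernel_sums: "(\<lambda>n. (-1) ^ n * scaled_alt_hurwitz_kernel c \<gamma> (real n + a) a k
      / of_real (real n + a) ^ (2 * k * (N + 1) - 1)) sums
      of_real (- (1 / (2 * \<gamma>)) * z (N + 1) + q \<gamma> / \<gamma> * double_series A (q \<gamma>) N)"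
    if \<gamma>: "\<gamma> > 0" for \<gamma>
  proof -
    have q: "q \<gamma> > 0" using \<gamma> by (simp add: q_def)
    have "(\<lambda>n. (-1) ^ n / A n ^ (N + 1)) sums z (N + 1)"
      using summable_sums[OF summable_rabs_cancel[OF summable_inverse_power[OF A_pos A_sum, of "N + 1"]]]
      by (simp add: z_def)
    moreover have "(\<lambda>n. (-1) ^ n / A n ^ N * (\<Sum>m. (-1) ^ m / (A m + q \<gamma> * A n))) sums double_series A (q \<gamma>) N"
      unfolding double_series_def[OF A_pos A_sum]
      by (intro summable_sums double_series_summable A_pos A_sum q assms)
    ultimately have "(\<lambda>n. - (1 / (2 * \<gamma>)) * ((-1) ^ n / A n ^ (N + 1)) + q \<gamma> / \<gamma> * ((-1) ^ n / A n ^ N * (\<Sum>m. (-1) ^ m / (A m + q \<gamma> * A n))))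
      sums (- (1 / (2 * \<gamma>)) * z (N + 1) + q \<gamma> / \<gamma> * double_series A (q \<gamma>) N)"
      by (intro sums_add sums_mult)
    then show ?thesis
      unfolding scaled_kernel_term[OF \<gamma> \<open>k \<ge> 1\<close> \<open>a > 0\<close> \<open>1 < c\<close> \<open>c < 2\<close>] A_def q_def sums_of_real_iff .
  qed
  have zeta: "zeta_E (of_nat (2 * k * p)) a = of_real (z p)" for p
  proof (cases "p = 0")
    case True
    then show ?thesis using zeta_E_0[OF \<open>a > 0\<close>] by (simp add: z_def)
  next
    case False
    have "(\<lambda>n. (-1) ^ n / A n ^ p) sums z p"
      using summable_sums[OF summable_rabs_cancel[OF summable_inverse_power[OF A_pos A_sum, of p]]] False
      by (simp add: z_def)
    then have "(\<lambda>n. complex_of_real ((-1) ^ n / A n ^ p)) sums of_real (z p)"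
      unfolding sums_of_real_iff .
    moreover have "complex_of_real ((-1) ^ n / A n ^ p) = (-1) ^ n / of_real (real n + a) ^ (2 * k * p)" for n
      by (simp add: A_def power_mult)
    ultimately show ?thesis
      using zeta_E_of_nat_sums[OF \<open>a > 0\<close>, of "2 * k * p"] assms False by (auto dest: sums_unique2)
  qed
  have powi: "complex_of_real t powi (int k * int p - 1) = of_real (t ^ (k * p) / t)" if "t > 0" for t p
    using that by (simp add: power_int_diff power_int_of_nat flip: of_nat_mult)
  have powi': "int k * (int N + 1 - int p) - 1 = int k * int (N + 1 - p) - 1" if "p \<le> N + 1" for p
    using that by (simp add: of_nat_diff)
  \<comment> \<open>Here \<open>\<alpha> * \<beta> = \<pi> ^ 2\<close> enters: it gives
    \<open>(\<alpha> / \<pi>) ^ 2 = \<alpha> / \<beta>\<close>, so the parameters of the two sides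
    are reciprocal.\<close>
  have q\<alpha>: "q \<alpha> = \<alpha> ^ k / \<beta> ^ k" and q\<beta>: "q \<beta> = \<beta> ^ k / \<alpha> ^ k"
  proof -
    have "(\<alpha> / pi) ^ 2 = \<alpha> / \<beta>" "(\<beta> / pi) ^ 2 = \<beta> / \<alpha>"
      using assms(1,2) unfolding power_divide assms(3)[symmetric] by (simp_all add: power2_eq_square)
    then show "q \<alpha> = \<alpha> ^ k / \<beta> ^ k" "q \<beta> = \<beta> ^ k / \<alpha> ^ k"
      by (simp_all add: q_def power_mult power_divide[symmetric])
  qed
  have q_pos: "q \<alpha> > 0" and q_inv: "q \<beta> = 1 / q \<alpha>"
    unfolding q\<alpha> q\<beta> using assms by simp_all
  have "(\<Sum>j<N. (- q \<alpha>) ^ j * ((\<Sum>n. (-1) ^ n / A n ^ (N - j)) * (\<Sum>n. (-1) ^ n / A n ^ Suc j)))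
      = (\<Sum>j<N. (- q \<alpha>) ^ j * (z (N - j) * z (Suc j)))"
    by (intro sum.cong refl) (auto simp: z_def)
  with double_series_reciprocity[OF A_pos A_sum q_pos \<open>N \<ge> 1\<close>]
  have "double_series A (q \<alpha>) N = (- q \<alpha>) ^ N / q \<alpha> * double_series A (q \<beta>) N
      + (\<Sum>j<N. (- q \<alpha>) ^ j * (z (N - j) * z (Suc j)))"
    unfolding q_inv by simp
  from reciprocity_arithmetic[where z = z, OF assms(1,2,4) q\<alpha> _ this]
  have main: "\<beta> ^ (k * (N + 1) - 1) * (- (1 / (2 * \<alpha>)) * z (N + 1) + q \<alpha> / \<alpha> * double_series A (q \<alpha>) N) =
    (-1) ^ N * \<alpha> ^ (k * (N + 1) - 1) * (- (1 / (2 * \<beta>)) * z (N + 1) + q \<beta> / \<beta> * double_series A (q \<beta>) N)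
    + (\<Sum>p=0..N+1. (-1) ^ (p + 1) * z p * z (N + 1 - p) * (\<alpha> ^ (k * p) / \<alpha>) * (\<beta> ^ (k * (N + 1 - p)) / \<beta>))"
    by (simp add: z_def q_inv)
  have rhs: "(\<Sum>p=0..N+1. (-1) ^ (p + 1)
                * zeta_E (of_nat (2 * k * p)) a * zeta_E (of_nat (2 * k * (N + 1 - p))) a
                * of_real \<alpha> powi (int k * int p - 1)
                * of_real \<beta> powi (int k * (int N + 1 - int p) - 1)) =
      complex_of_real (\<Sum>p=0..N+1. (-1) ^ (p + 1) * z p * z (N + 1 - p) * (\<alpha> ^ (k * p) / \<alpha>) * (\<beta> ^ (k * (N + 1 - p)) / \<beta>))"
    unfolding of_real_sum
    by (intro sum.cong refl)
       (simp only: zeta powi' atLeastAtMost_iff powi[OF assms(1)] powi[OF assms(2)] of_real_mult of_real_power of_real_minus of_real_1)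
  show ?thesis
    unfolding rhs sums_unique[OF kernel_sums[OF assms(1)], symmetric] sums_unique[OF kernel_sums[OF assms(2)], symmetric]
    using sums_summable[OF kernel_sums[OF assms(1)]] sums_summable[OF kernel_sums[OF assms(2)]]
      arg_cong[OF main, of complex_of_real]
    by (simp only: of_real_add of_real_mult of_real_power of_real_minus of_real_1) simp
qed

end
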